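(* Let $\sigma=\{\pi_i \mid i\in I\}$ be a partition of the set of all primes into mutually disjoint subsets, let $G$ be a finite group and let $H$ be a $\sigma^{(3)}$-permutable subgroup of $G$. Then the normalizer $N_G(H)$ is also $\sigma^{(3)}$-permutable in $G$.
   Context: All groups are finite. $\sigma=\{\pi_i \mid i\in I\}$ is a partition of the set $\mathbb{P}$ of all primes: $\pi_i\cap\pi_j=\emptyset$ for $i\neq j$ and $\bigcup_{i\in I}\pi_i=\mathbb{P}$. We write $P^x=x^{-1}Px$. For a set of primes $\pi$, $\mathfrak{G}_\pi$ denotes the class of all finite $\pi$-groups. A subgroup $P$ of $G$ is a $\mathfrak{G}_\pi$-projector of $G$ if, for every normal subgroup $N$ of $G$, $PN/N$ is $\mathfrak{G}_\pi$-maximal in $G/N$, i.e. $PN/N$ is a $\pi$-subgroup of $G/N$ not properly contained in any other $\pi$-subgroup of $G/N$. (Such projectors exist in every finite group.) A subgroup $H$ of $G$ is called $\sigma^{(3)}$-permutable if for every $\pi_i\in\sigma$ there is a $\mathfrak{G}_{\pi_i}$-projector $P$ of $G$ such that $HP^x=P^xH$ for all $x\in G$. *)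

theory Defs
  imports
    "HOL-Algebra.Group_Action"
    "HOL-Computational_Algebra.Primes"
    "HOL-Library.Disjoint_Sets"
begin

definition pi_group :: "nat set \<Rightarrow> ('a, 'b) monoid_scheme \<Rightarrow> bool" where
  "pi_group \<pi> G \<longleftrightarrow>
     group G \<and> finite (carrier G) \<and> (\<forall>p. Factorial_Ring.prime p \<and> p dvd order G \<longrightarrow> p \<in> \<pi>)"

definition pi_subgroup :: "nat set \<Rightarrow> ('a, 'b) monoid_scheme \<Rightarrow> 'a set \<Rightarrow> bool" where
  "pi_subgroup \<pi> G K \<longleftrightarrow> subgroup K G \<and> pi_group \<pi> (G\<lparr>carrier := K\<rparr>)"

definition maximal_pi_subgroup :: "nat set \<Rightarrow> ('a, 'b) monoid_scheme \<Rightarrow> 'a set \<Rightarrow> bool" where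
  "maximal_pi_subgroup \<pi> G K \<longleftrightarrow>
     pi_subgroup \<pi> G K \<and> \<not> (\<exists>L. pi_subgroup \<pi> G L \<and> K \<subset> L)"

text \<open>The subgroup \<open>PN/N\<close> of \<open>G/N\<close> is written as the carrier of the factor group of \<open>PN\<close> by \<open>N\<close>,
  that is, the set of cosets of \<open>N\<close> in \<open>G\<close> that are contained in \<open>PN\<close>.\<close>

definition pi_projector :: "nat set \<Rightarrow> ('a, 'b) monoid_scheme \<Rightarrow> 'a set \<Rightarrow> bool" where
  "pi_projector \<pi> G P \<longleftrightarrow>
     subgroup P G \<and>
     (\<forall>N. N \<lhd> G \<longrightarrow>
        maximal_pi_subgroup \<pi> (G Mod N) (carrier (G\<lparr>carrier := P <#>\<^bsub>G\<^esub> N\<rparr> Mod N)))"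

text \<open>The exponent convention is \<open>P\<^sup>x = x\<^sup>-\<^sup>1Px\<close>.\<close>

definition conjugate_by :: "('a, 'b) monoid_scheme \<Rightarrow> 'a set \<Rightarrow> 'a \<Rightarrow> 'a set" where
  "conjugate_by G P x = inv\<^bsub>G\<^esub> x <#\<^bsub>G\<^esub> P #>\<^bsub>G\<^esub> x"

definition sigma3_permutable :: "nat set set \<Rightarrow> ('a, 'b) monoid_scheme \<Rightarrow> 'a set \<Rightarrow> bool" where
  "sigma3_permutable \<sigma> G H \<longleftrightarrow>
     subgroup H G \<and>
     (\<forall>\<pi>\<in>\<sigma>. \<exists>P. pi_projector \<pi> G P \<and>
        (\<forall>x\<in>carrier G. H <#>\<^bsub>G\<^esub> conjugate_by G P x = conjugate_by G P x <#>\<^bsub>G\<^esub> H))"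

end

theory Submission
  imports Defs "HOL-Algebra.Multiplicative_Group" "HOL-Algebra.Sylow"
begin

text \<open>Write \<open>H\<^sub>G\<close> for the largest normal subgroup of \<open>G\<close> inside \<open>H\<close>, and for each class \<open>\<pi>\<close> of the
  partition let \<open>Q \<pi>\<close> be the set of conjugates of the given projector.  The normalizer permutes
  with the very same projectors as \<open>H\<close>.  The reason is that \<open>H\<close> modulo \<open>H\<^sub>G\<close> is a direct product of
  \<open>\<pi>\<close>-groups, each of which is normalized by the projectors of all the other classes.

  The heart is the statement that, for \<open>p \<in> \<pi>\<close>, every element of \<open>p\<close>-power order of \<open>H\<close> lies in
  \<open>H\<^sub>G B\<close> for all \<open>B \<in> Q \<pi>\<close> (\<open>permutable_primary_elements_in_radicals\<close>); the intersection of these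
  products is a normal subgroup \<open>O\<^sub>\<pi>\<close> which is a \<open>\<pi>\<close>-group modulo \<open>H\<^sub>G\<close>.  It is proved by moving
  from larger to smaller subgroups.  If \<open>H\<close> is not normal, some element \<open>b\<close> of some \<open>B \<in> Q \<pi>\<close> does
  not normalize \<open>H\<close>; then \<open>H\<close> and its conjugate by \<open>b\<close> generate a strictly larger subgroup \<open>A\<close>
  that permutes with the family again, and because \<open>A\<close> lies in \<open>HB\<close> the index of \<open>H\<close> in \<open>A\<close>
  is a \<open>\<pi>\<close>-number.  For a class \<open>\<rho>\<close> other than \<open>\<pi>\<close> and \<open>B' \<in> Q \<rho>\<close>, the
  index of \<open>H\<close> in \<open>HB'\<close> is a \<open>\<rho>\<close>-number, so \<open>HB'\<close> meets \<open>A\<close> exactly in \<open>H\<close>.  All the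
  information about \<open>A\<close> is brought down to \<open>H\<close> through this coincidence
  (\<open>permutable_product_Int\<close>, \<open>same_index_outside_cores\<close>, \<open>primary_elements_in_radicals_step\<close>).

  The same comparison of indices shows that \<open>H \<inter> O\<^sub>\<pi>\<close> is normalized by all members of \<open>Q \<rho>\<close> with
  \<open>\<rho> \<noteq> \<pi>\<close>, hence by the normal subgroup \<open>R\<^sub>\<pi>\<close> that they generate.  Since \<open>H\<close> is generated by its
  elements of prime power order, its normalizer is the intersection of the normalizers of the
  groups \<open>H \<inter> O\<^sub>\<pi>\<close>.  A projector \<open>B \<in> Q \<pi>\<close> lies in every term of this intersection except perhaps
  the one for \<open>\<pi>\<close>, and that one contains \<open>R\<^sub>\<pi>\<close>, where \<open>G = B R\<^sub>\<pi>\<close>.  The modular law then makes \<open>B\<close>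
  and the normalizer permute (\<open>permutable_normalizer\<close>).

  The projector property enters through two facts: the members of \<open>Q \<pi>\<close> are \<open>\<pi>\<close>-groups, and if \<open>N\<close>
  is normal and a subgroup \<open>L\<close> contains \<open>BN\<close> with \<open>N\<close> of \<open>\<pi>\<close>-index in \<open>L\<close>, then \<open>L = BN\<close>.  Once these are
  known, quotient groups give way to a comparison, for each prime outside a class, of the exponents
  of that prime in the orders of two subgroups.\<close>

section \<open>Prime parts of subgroup orders in a finite group\<close>

abbreviation p_part :: "nat \<Rightarrow> 'a set \<Rightarrow> nat" where
  "p_part p K \<equiv> multiplicity p (card K)"

locale finite_group = group +
  assumes finite_carrier: "finite (carrier G)"
begin

lemma inv_mult_cancel [simp]:
  "x \<in> carrier G \<Longrightarrow> y \<in> carrier G \<Longrightarrow> inv x \<otimes> (x \<otimes> y) = y"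
  "x \<in> carrier G \<Longrightarrow> y \<in> carrier G \<Longrightarrow> x \<otimes> (inv x \<otimes> y) = y"
  by (metis inv_closed l_inv l_one m_assoc) (metis inv_closed r_inv l_one m_assoc)

lemma finite_subgroup [simp]: "subgroup K G \<Longrightarrow> finite K"
  using finite_carrier finite_subset subgroup.subset by blast

lemma card_subgroup_pos: "subgroup K G \<Longrightarrow> card K > 0"
  using finite_subgroup subgroup.one_closed card_gt_0_iff by fastforce

lemma card_subgroup_dvd:
  assumes "subgroup K G" "subgroup L G" "K \<subseteq> L"
  shows "card K dvd card L"
proof -
  interpret L: group "G\<lparr>carrier := L\<rparr>" using assms(2) subgroup_imp_group by blast
  have "subgroup K (G\<lparr>carrier := L\<rparr>)" using assms subgroup_incl by blast
  from L.lagrange[OF this] have "card L = card (rcosets\<^bsub>G\<lparr>carrier := L\<rparr>\<^esub> K) * card K" by (simp add: order_def)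
  then show ?thesis by simp
qed

lemma p_part_mono:
  assumes "subgroup K G" "subgroup L G" "K \<subseteq> L"
  shows "p_part p K \<le> p_part p L"
  using assms card_subgroup_dvd card_subgroup_pos by (intro dvd_imp_multiplicity_le) fastforce+

text \<open>Every fibre of the multiplication map \<open>H \<times> K \<rightarrow> HK\<close> is a translate of \<open>H \<inter> K\<close>.\<close>

lemma card_set_mult:
  assumes H: "subgroup H G" and K: "subgroup K G"
  shows "card (H <#> K) * card (H \<inter> K) = card H * card K"
proof -
  interpret H: subgroup H G by fact
  interpret K: subgroup K G by fact
  let ?f = "\<lambda>(h, k). h \<otimes> k"
  have img: "H <#> K = ?f ` (H \<times> K)" by (auto simp: set_mult_def)
  have fib: "card {x \<in> H \<times> K. ?f x = y} = card (H \<inter> K)" if "y \<in> H <#> K" for y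
  proof -
    from that obtain h0 k0 where y: "h0 \<in> H" "k0 \<in> K" "y = h0 \<otimes> k0" by (auto simp: set_mult_def)
    have "bij_betw (\<lambda>z. (h0 \<otimes> z, inv z \<otimes> k0)) (H \<inter> K) {x \<in> H \<times> K. ?f x = y}"
    proof (rule bij_betw_imageI)
      show "inj_on (\<lambda>z. (h0 \<otimes> z, inv z \<otimes> k0)) (H \<inter> K)"
        using y by (auto simp: inj_on_def)
      show "(\<lambda>z. (h0 \<otimes> z, inv z \<otimes> k0)) ` (H \<inter> K) = {x \<in> H \<times> K. ?f x = y}"
      proof (intro equalityI subsetI)
        fix x assume "x \<in> (\<lambda>z. (h0 \<otimes> z, inv z \<otimes> k0)) ` (H \<inter> K)"
        then obtain z where z: "z \<in> H" "z \<in> K" "x = (h0 \<otimes> z, inv z \<otimes> k0)" by auto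
        have "h0 \<otimes> z \<otimes> (inv z \<otimes> k0) = h0 \<otimes> k0"
          using z y by (simp add: m_assoc)
        then show "x \<in> {x \<in> H \<times> K. ?f x = y}" using z y by auto
      next
        fix x assume x: "x \<in> {x \<in> H \<times> K. ?f x = y}"
        obtain h k where hk: "x = (h, k)" "h \<in> H" "k \<in> K" "h \<otimes> k = h0 \<otimes> k0" using x y by auto
        have c: "h \<in> carrier G" "k \<in> carrier G" "h0 \<in> carrier G" "k0 \<in> carrier G"
          using hk y by auto
        have "inv h0 \<otimes> h = inv h0 \<otimes> (h \<otimes> k) \<otimes> inv k" using c by (simp add: m_assoc)
        also have "\<dots> = k0 \<otimes> inv k" unfolding hk(4) using c by (simp add: m_assoc)
        finally have z: "inv h0 \<otimes> h = k0 \<otimes> inv k" .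
        have "inv h0 \<otimes> h \<in> H" using hk(2) y(1) by simp
        moreover have "inv h0 \<otimes> h \<in> K" unfolding z using hk(3) y(2) by simp
        ultimately have mem: "inv h0 \<otimes> h \<in> H \<inter> K" by (rule IntI)
        have "inv (inv h0 \<otimes> h) \<otimes> k0 = k" unfolding z using c by (simp add: inv_mult_group m_assoc)
        then have "(\<lambda>z. (h0 \<otimes> z, inv z \<otimes> k0)) (inv h0 \<otimes> h) = x" using c hk(1) by simp
        then show "x \<in> (\<lambda>z. (h0 \<otimes> z, inv z \<otimes> k0)) ` (H \<inter> K)" using mem by (rule image_eqI[OF sym])
      qed
    qed
    from bij_betw_same_card[OF this] show ?thesis by simp
  qed
  have fin: "finite (H \<times> K)" using H K by simp
  have "card H * card K = card (H \<times> K)" by (simp add: card_cartesian_product)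
  also have "\<dots> = (\<Sum>y\<in>H <#> K. card {x \<in> H \<times> K. ?f x = y})"
  proof -
    have "H \<times> K = (\<Union>y\<in>H <#> K. {x \<in> H \<times> K. ?f x = y})" unfolding img by auto
    then have "card (H \<times> K) = card (\<Union>y\<in>H <#> K. {x \<in> H \<times> K. ?f x = y})" by simp
    also have "\<dots> = (\<Sum>y\<in>H <#> K. card {x \<in> H \<times> K. ?f x = y})"
      by (rule card_UN_disjoint) (use fin in \<open>auto simp: img\<close>)
    finally show ?thesis .
  qed
  also have "\<dots> = card (H <#> K) * card (H \<inter> K)" using fib by simp
  finally show ?thesis by simp
qed

lemma p_part_set_mult:
  assumes "subgroup H G" "subgroup K G" "Factorial_Ring.prime p"
  shows "p_part p (H <#> K) + p_part p (H \<inter> K) = p_part p H + p_part p K"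
proof -
  have pos: "card H \<noteq> 0" "card K \<noteq> 0" "card (H \<inter> K) \<noteq> 0"
    using assms card_subgroup_pos subgroups_Inter_pair by (metis gr_implies_not0)+
  moreover have "card (H <#> K) \<noteq> 0" using card_set_mult[OF assms(1,2)] pos by (metis mult_is_0)
  ultimately show ?thesis
    using card_set_mult[OF assms(1,2)] assms(3)
    by (metis prime_elem_multiplicity_mult_distrib prime_imp_prime_elem)
qed

lemma subgroup_eqI_p_part:
  assumes "subgroup K G" "subgroup L G" "K \<subseteq> L" "\<And>p. Factorial_Ring.prime p \<Longrightarrow> p_part p K = p_part p L"
  shows "K = L"
proof -
  have "normalize (card K) = normalize (card L)"
    by (rule multiplicity_eq_imp_eq) (use assms(4) card_subgroup_pos[OF assms(1)] card_subgroup_pos[OF assms(2)] in \<open>auto simp del: card_gt_0_iff card_0_eq\<close>)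
  then have "card K = card L" by simp
  then show ?thesis using assms(2,3) by (simp add: card_subset_eq)
qed

definition p_element :: "nat \<Rightarrow> 'a \<Rightarrow> bool" where
  "p_element p g \<longleftrightarrow> g \<in> carrier G \<and> (\<exists>k. g [^] (p ^ k) = \<one>)"

lemma p_element_conj:
  assumes "p_element p g" "x \<in> carrier G"
  shows "p_element p (x \<otimes> g \<otimes> inv x)"
proof -
  have g: "g \<in> carrier G" using assms by (simp add: p_element_def)
  have "(x \<otimes> g \<otimes> inv x) [^] n = x \<otimes> g [^] n \<otimes> inv x" for n :: nat
  proof (induction n)
    case (Suc n)
    have "(x \<otimes> g \<otimes> inv x) [^] Suc n = (x \<otimes> g [^] n \<otimes> inv x) \<otimes> (x \<otimes> g \<otimes> inv x)"
      using Suc by simp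
    also have "\<dots> = x \<otimes> g [^] Suc n \<otimes> inv x"
      using g assms by (simp add: m_assoc)
    finally show ?case .
  qed (use assms in simp)
  moreover obtain k where "g [^] (p ^ k) = \<one>" using assms by (auto simp: p_element_def)
  ultimately have "(x \<otimes> g \<otimes> inv x) [^] (p ^ k) = \<one>" using assms(2) by simp
  then show ?thesis using assms(2) g unfolding p_element_def by blast
qed

lemma p_element_of_p_subgroup:
  assumes S: "subgroup S G" "card S = p ^ k" "s \<in> S"
  shows "p_element p s"
proof -
  interpret S: group "G\<lparr>carrier := S\<rparr>" using S(1) subgroup_imp_group by blast
  have "s [^]\<^bsub>G\<lparr>carrier := S\<rparr>\<^esub> order (G\<lparr>carrier := S\<rparr>) = \<one>"
    using S.pow_order_eq_1[of s] S(3) by simp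
  then have "s [^] (p ^ k) = \<one>" using nat_pow_consistent[of s _ S] by (simp add: order_def S(2))
  moreover have "s \<in> carrier G" using S(1,3) by (rule subgroup.mem_carrier)
  ultimately show ?thesis by (auto simp: p_element_def)
qed

lemma generate_p_element:
  assumes "p_element p g" "Factorial_Ring.prime p"
  obtains S k where "subgroup S G" "g \<in> S" "card S = p ^ k" "\<And>K. subgroup K G \<Longrightarrow> g \<in> K \<Longrightarrow> S \<subseteq> K"
proof -
  obtain n where g: "g \<in> carrier G" "g [^] (p ^ n) = \<one>" using assms by (auto simp: p_element_def)
  have "ord g dvd p ^ n" using g pow_eq_id by blast
  then obtain k where "ord g = p ^ k" using divides_primepow_nat[OF assms(2)] by blast
  then have "card (generate G {g}) = p ^ k" using generate_pow_card g by simp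
  then show ?thesis
    using that[of "generate G {g}" k] g generate_is_subgroup[of "{g}"] generate.incl[of g "{g}" G]
      generate_subgroup_incl[of "{g}"] by simp
qed

text \<open>A Sylow \<open>p\<close>-subgroup of \<open>L\<close> consists of \<open>p\<close>-elements and so lies in \<open>K\<close>.\<close>

lemma p_part_eqI_p_elements:
  assumes K: "subgroup K G" "subgroup L G" "K \<subseteq> L" and p: "Factorial_Ring.prime p"
    and elems: "\<And>g. g \<in> L \<Longrightarrow> p_element p g \<Longrightarrow> g \<in> K"
  shows "p_part p K = p_part p L"
proof (rule antisym[OF p_part_mono[OF K]])
  interpret L: group "G\<lparr>carrier := L\<rparr>" using K(2) subgroup_imp_group by blast
  let ?a = "p_part p L"
  obtain m where m: "order (G\<lparr>carrier := L\<rparr>) = p ^ ?a * m"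
    using multiplicity_dvd[of p "card L"] by (auto simp: order_def dvd_def)
  have fin: "finite (carrier (G\<lparr>carrier := L\<rparr>))" using K by simp
  obtain S where S: "subgroup S (G\<lparr>carrier := L\<rparr>)" "card S = p ^ ?a"
    using sylow_thm[OF p L.group_axioms m fin] by blast
  have SG: "subgroup S G" using S(1) K(2) incl_subgroup by blast
  have SL: "S \<subseteq> L" using subgroup.subset[OF S(1)] by simp
  have "S \<subseteq> K" using elems p_element_of_p_subgroup[OF SG S(2)] SL by blast
  then have "p ^ ?a dvd card K" using card_subgroup_dvd[OF SG K(1)] S(2) by simp
  then show "?a \<le> p_part p K"
    using card_subgroup_pos[OF K(1)] p by (intro multiplicity_geI) (auto dest: prime_gt_1_nat)
qed

text \<open>A finite group is generated by its elements of prime power order, in the form that is convenient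
  for comparing subgroups.\<close>

lemma subgroup_eqI_p_elements:
  assumes "subgroup K G" "subgroup L G" "K \<subseteq> L"
    and "\<And>p g. Factorial_Ring.prime p \<Longrightarrow> g \<in> L \<Longrightarrow> p_element p g \<Longrightarrow> g \<in> K"
  shows "K = L"
  using assms by (intro subgroup_eqI_p_part p_part_eqI_p_elements) auto

lemma mem_normalizer_iff:
  assumes K: "K \<subseteq> carrier G"
  shows "g \<in> normalizer G K \<longleftrightarrow> g \<in> carrier G \<and> (\<forall>k\<in>K. g \<otimes> k \<otimes> inv g \<in> K)"
proof -
  have eq: "g <# K #> inv g = (\<lambda>k. g \<otimes> k \<otimes> inv g) ` K" by (auto simp: l_coset_def r_coset_def)
  have "(\<lambda>k. g \<otimes> k \<otimes> inv g) ` K = K" if "g \<in> carrier G" "\<forall>k\<in>K. g \<otimes> k \<otimes> inv g \<in> K"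
  proof (rule endo_inj_surj)
    show "finite K" using K finite_carrier finite_subset by blast
    show "inj_on (\<lambda>k. g \<otimes> k \<otimes> inv g) K" using that K by (auto simp: inj_on_def subset_iff)
  qed (use that in auto)
  then show ?thesis using K by (auto simp: normalizer_def stabilizer_def eq)
qed

lemma subgroup_normalizer: "K \<subseteq> carrier G \<Longrightarrow> subgroup (normalizer G K) G"
  by (rule normalizer_imp_subgroup)

lemma subgroup_conj_mem: "subgroup K G \<Longrightarrow> g \<in> K \<Longrightarrow> k \<in> K \<Longrightarrow> g \<otimes> k \<otimes> inv g \<in> K"
  by (simp add: subgroup.m_closed subgroup.m_inv_closed)

lemma set_multI: "a \<in> A \<Longrightarrow> b \<in> B \<Longrightarrow> a \<otimes> b \<in> A <#> B"
  unfolding set_mult_def by blast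

lemma set_mult_subset:
  assumes "subgroup L G" "A \<subseteq> L" "B \<subseteq> L" shows "A <#> B \<subseteq> L"
  using subgroup.m_closed[OF assms(1)] assms(2,3) unfolding set_mult_def by blast

lemma subset_set_mult_left:
  assumes "subgroup B G" "A \<subseteq> carrier G" shows "A \<subseteq> A <#> B"
proof
  fix a assume "a \<in> A"
  then show "a \<in> A <#> B" using set_multI[of a A \<one> B] subgroup.one_closed[OF assms(1)] assms(2) by auto
qed

lemma subset_set_mult_right:
  assumes "subgroup A G" "B \<subseteq> carrier G" shows "B \<subseteq> A <#> B"
proof
  fix b assume "b \<in> B"
  then show "b \<in> A <#> B" using set_multI[of \<one> A b B] subgroup.one_closed[OF assms(1)] assms(2) by auto
qed

text \<open>Taking inverses exchanges \<open>AB\<close> and \<open>BA\<close>, so one inclusion is enough.\<close>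

lemma set_mult_commuteI:
  assumes A: "subgroup A G" and B: "subgroup B G"
    and sub: "\<And>a b. a \<in> A \<Longrightarrow> b \<in> B \<Longrightarrow> a \<otimes> b \<in> B <#> A"
  shows "A <#> B = B <#> A"
proof
  show "A <#> B \<subseteq> B <#> A" using sub by (auto simp: set_mult_def)
  show "B <#> A \<subseteq> A <#> B"
  proof
    fix x assume "x \<in> B <#> A"
    then obtain b a where x: "b \<in> B" "a \<in> A" "x = b \<otimes> a" by (auto simp: set_mult_def)
    have "inv a \<otimes> inv b \<in> B <#> A" using sub x A B by (simp add: subgroup.m_inv_closed)
    then obtain b' a' where y: "b' \<in> B" "a' \<in> A" "inv a \<otimes> inv b = b' \<otimes> a'" by (auto simp: set_mult_def)
    have c: "a \<in> carrier G" "b \<in> carrier G" "a' \<in> carrier G" "b' \<in> carrier G"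
      using x y subgroup.mem_carrier[OF A] subgroup.mem_carrier[OF B] by auto
    have "x = inv (inv a \<otimes> inv b)" using x c by (simp add: inv_mult_group)
    also have "\<dots> = inv a' \<otimes> inv b'" using y c by (simp add: inv_mult_group)
    finally show "x \<in> A <#> B" using y A B by (auto intro!: set_multI subgroup.m_inv_closed)
  qed
qed

lemma set_mult_exchange:
  assumes "A <#> B = B <#> A" "a \<in> A" "b \<in> B"
  obtains b' a' where "b' \<in> B" "a' \<in> A" "a \<otimes> b = b' \<otimes> a'"
proof -
  have "a \<otimes> b \<in> B <#> A" using set_multI[OF assms(2,3)] assms(1) by simp
  then show ?thesis using that unfolding set_mult_def by blast
qed

lemma subgroup_set_mult:
  assumes A: "subgroup A G" and B: "subgroup B G" and comm: "A <#> B = B <#> A"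
  shows "subgroup (A <#> B) G"
proof (rule subgroupI)
  show "A <#> B \<subseteq> carrier G" using A B by (simp add: set_mult_closed subgroup.subset)
  show "A <#> B \<noteq> {}" using A B subgroup.one_closed set_multI by blast
next
  fix x assume "x \<in> A <#> B"
  then obtain a b where x: "a \<in> A" "b \<in> B" "x = a \<otimes> b" by (auto simp: set_mult_def)
  have c: "a \<in> carrier G" "b \<in> carrier G" using x subgroup.mem_carrier[OF A] subgroup.mem_carrier[OF B] by auto
  have "inv x = inv b \<otimes> inv a" using x c by (simp add: inv_mult_group)
  then show "inv x \<in> A <#> B" using x A B comm by (auto intro!: set_multI subgroup.m_inv_closed)
next
  fix x y assume "x \<in> A <#> B" "y \<in> A <#> B"
  then obtain a b c d where x: "a \<in> A" "b \<in> B" "x = a \<otimes> b" and y: "c \<in> A" "d \<in> B" "y = c \<otimes> d"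
    by (auto simp: set_mult_def)
  obtain c' b' where e: "c' \<in> A" "b' \<in> B" "b \<otimes> c = c' \<otimes> b'"
    using set_mult_exchange[OF comm[symmetric] x(2) y(1)] by blast
  have cc: "a \<in> carrier G" "b \<in> carrier G" "c \<in> carrier G" "d \<in> carrier G" "b' \<in> carrier G" "c' \<in> carrier G"
    using x y e subgroup.mem_carrier[OF A] subgroup.mem_carrier[OF B] by auto
  have "x \<otimes> y = a \<otimes> (b \<otimes> c) \<otimes> d" using x y cc by (simp add: m_assoc)
  also have "\<dots> = (a \<otimes> c') \<otimes> (b' \<otimes> d)" unfolding e(3) using cc by (simp add: m_assoc)
  finally show "x \<otimes> y \<in> A <#> B" using x y e A B by (auto intro!: set_multI subgroup.m_closed)
qed

lemma set_mult_commute_normalizer: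
  assumes K: "subgroup K G" and S: "subgroup S G" and nrm: "S \<subseteq> normalizer G K"
  shows "S <#> K = K <#> S"
proof (rule set_mult_commuteI[OF S K])
  fix s k assume sk: "s \<in> S" "k \<in> K"
  have c: "s \<in> carrier G" "k \<in> carrier G" using sk subgroup.mem_carrier[OF K] subgroup.mem_carrier[OF S] by auto
  have "s \<otimes> k = (s \<otimes> k \<otimes> inv s) \<otimes> s" using c by (simp add: m_assoc)
  moreover have "s \<otimes> k \<otimes> inv s \<in> K"
    using sk nrm K by (auto simp: mem_normalizer_iff subgroup.subset)
  ultimately show "s \<otimes> k \<in> K <#> S" using sk(1) by (metis set_multI)
qed

lemma normal_subset_normalizer: "N \<lhd> G \<Longrightarrow> carrier G \<subseteq> normalizer G N"
  by (auto simp: mem_normalizer_iff normal_inv_iff subgroup.subset)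

lemma set_mult_commute_normal:
  assumes "N \<lhd> G" "subgroup S G"
  shows "S <#> N = N <#> S"
  using set_mult_commute_normalizer[OF normal_imp_subgroup[OF assms(1)] assms(2)]
    normal_subset_normalizer[OF assms(1)] subgroup.subset[OF assms(2)] by auto

text \<open>If \<open>S\<close> is the cyclic group generated by \<open>g\<close>, then \<open>KS\<close> lies between \<open>K\<close> and \<open>L\<close>, so the product
  formula makes \<open>K \<inter> S\<close> and the \<open>p\<close>-group \<open>S\<close> have the same order.  This is the form, for
  \<open>K\<close> normalized by \<open>g\<close>, of the remark that a \<open>p\<close>-element vanishes in a quotient of order prime to \<open>p\<close>.\<close>

lemma p_element_mem_of_p_part_eq:
  assumes K: "subgroup K G" "subgroup L G" "K \<subseteq> L" and p: "Factorial_Ring.prime p"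
    and eq: "p_part p K = p_part p L"
    and g: "g \<in> L" "p_element p g" "g \<in> normalizer G K"
  shows "g \<in> K"
proof -
  obtain S k where S: "subgroup S G" "g \<in> S" "card S = p ^ k"
    "\<And>K. subgroup K G \<Longrightarrow> g \<in> K \<Longrightarrow> S \<subseteq> K"
    using generate_p_element[OF g(2) p] by blast
  have SN: "S \<subseteq> normalizer G K"
    using S(4)[OF subgroup_normalizer[OF subgroup.subset[OF K(1)]] g(3)] .
  have comm: "S <#> K = K <#> S" by (rule set_mult_commute_normalizer[OF K(1) S(1) SN])
  have T: "subgroup (K <#> S) G" using subgroup_set_mult[OF K(1) S(1)] comm by simp
  have TL: "K <#> S \<subseteq> L" using set_mult_subset[OF K(2,3)] S(4)[OF K(2) g(1)] by blast
  have "p_part p (K <#> S) = p_part p K"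
    using p_part_mono[OF T K(2) TL, of p] p_part_mono[OF K(1) T subset_set_mult_left[OF S(1) subgroup.subset[OF K(1)]], of p] eq by simp
  then have pp: "p_part p (K \<inter> S) = p_part p S" using p_part_set_mult[OF K(1) S(1) p] by simp
  have KS: "subgroup (K \<inter> S) G" by (rule subgroups_Inter_pair[OF K(1) S(1)])
  have "K \<inter> S = S"
  proof (rule subgroup_eqI_p_part[OF KS S(1)])
    fix q :: nat assume q: "Factorial_Ring.prime q"
    show "p_part q (K \<inter> S) = p_part q S"
    proof (cases "q = p")
      case False
      then have "p_part q S = 0" using q p S(3) by (simp add: prime_multiplicity_other multiplicity_distinct_prime_power)
      then show ?thesis using p_part_mono[OF KS S(1), of q] by simp
    qed (use pp in simp)
  qed simp
  then show ?thesis using S(2) by blast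
qed

lemma subgroup_normal_set_mult:
  assumes N: "N \<lhd> G" and B: "subgroup B G"
  shows "subgroup (N <#> B) G"
  using subgroup_set_mult[OF normal_imp_subgroup[OF N] B] set_mult_commute_normal[OF N B] by simp

section \<open>Conjugation and normal cores\<close>

lemma conj_mult:
  "x \<in> carrier G \<Longrightarrow> a \<in> carrier G \<Longrightarrow> b \<in> carrier G \<Longrightarrow>
    x \<otimes> (a \<otimes> b) \<otimes> inv x = (x \<otimes> a \<otimes> inv x) \<otimes> (x \<otimes> b \<otimes> inv x)"
  by (simp add: m_assoc)

lemma conj_conj:
  "x \<in> carrier G \<Longrightarrow> y \<in> carrier G \<Longrightarrow> a \<in> carrier G \<Longrightarrow>
    x \<otimes> (y \<otimes> a \<otimes> inv y) \<otimes> inv x = (x \<otimes> y) \<otimes> a \<otimes> inv (x \<otimes> y)"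
  by (simp add: m_assoc inv_mult_group)

lemma conj_inv:
  "x \<in> carrier G \<Longrightarrow> a \<in> carrier G \<Longrightarrow> x \<otimes> inv a \<otimes> inv x = inv (x \<otimes> a \<otimes> inv x)"
  by (simp add: m_assoc inv_mult_group)

abbreviation conj_set :: "'a \<Rightarrow> 'a set \<Rightarrow> 'a set" where
  "conj_set g K \<equiv> (\<lambda>k. g \<otimes> k \<otimes> inv g) ` K"

lemma subgroup_conj_set:
  assumes "subgroup K G" "g \<in> carrier G"
  shows "subgroup (conj_set g K) G"
proof (rule subgroupI)
  interpret K: subgroup K G by fact
  show "conj_set g K \<subseteq> carrier G" using assms(2) by auto
  show "conj_set g K \<noteq> {}" using K.one_closed by blast
  show "inv a \<in> conj_set g K" if "a \<in> conj_set g K" for a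
  proof -
    from that obtain k where k: "k \<in> K" "a = g \<otimes> k \<otimes> inv g" by blast
    then have "inv a = g \<otimes> inv k \<otimes> inv g" using assms(2) by (simp add: conj_inv)
    then show ?thesis using k by blast
  qed
  show "a \<otimes> b \<in> conj_set g K" if ab: "a \<in> conj_set g K" "b \<in> conj_set g K" for a b
  proof -
    from ab obtain k l where k: "k \<in> K" "a = g \<otimes> k \<otimes> inv g" "l \<in> K" "b = g \<otimes> l \<otimes> inv g" by blast
    then have "a \<otimes> b = g \<otimes> (k \<otimes> l) \<otimes> inv g" using assms(2) by (simp add: conj_mult)
    then show ?thesis using k by blast
  qed
qed

lemma normalI_conj:
  assumes "subgroup N G" "\<And>g n. g \<in> carrier G \<Longrightarrow> n \<in> N \<Longrightarrow> g \<otimes> n \<otimes> inv g \<in> N"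
  shows "N \<lhd> G"
  using assms by (simp add: normal_inv_iff)

lemma normal_conj_mem: "N \<lhd> G \<Longrightarrow> g \<in> carrier G \<Longrightarrow> n \<in> N \<Longrightarrow> g \<otimes> n \<otimes> inv g \<in> N"
  by (simp add: normal_inv_iff)

lemma generate_mem_normalizerI:
  assumes X: "X \<subseteq> carrier G" and g: "g \<in> carrier G"
    and closed: "\<And>x. x \<in> X \<Longrightarrow> g \<otimes> x \<otimes> inv g \<in> X"
  shows "g \<in> normalizer G (generate G X)"
proof -
  note sub = generate_is_subgroup[OF X]
  have "g \<otimes> k \<otimes> inv g \<in> generate G X" if "k \<in> generate G X" for k
    using that
  proof (induction k rule: generate.induct)
    case one
    show ?case using g by (simp add: generate.one)
  next
    case (incl h)
    then show ?case by (intro generate.incl closed)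
  next
    case (inv h)
    then have "h \<in> carrier G" using X by blast
    then show ?case using generate.inv[OF closed[OF inv]] g by (simp add: conj_inv)
  next
    case (eng a b)
    then have "a \<in> carrier G" "b \<in> carrier G" using subgroup.mem_carrier[OF sub] by auto
    then show ?case using conj_mult[OF g] generate.eng[OF eng.IH] by simp
  qed
  then show ?thesis using mem_normalizer_iff[OF subgroup.subset[OF sub]] g by blast
qed

text \<open>For a subgroup \<open>H\<close> this is \<open>H\<^sub>G\<close>, the largest normal subgroup of \<open>G\<close> contained in \<open>H\<close>.\<close>

definition core :: "'a set \<Rightarrow> 'a set" where
  "core H = {h \<in> carrier G. \<forall>g\<in>carrier G. g \<otimes> h \<otimes> inv g \<in> H}"

lemma core_subset: "core H \<subseteq> H"
proof
  fix h assume "h \<in> core H"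
  then have "h \<in> carrier G" "\<one> \<otimes> h \<otimes> inv \<one> \<in> H" unfolding core_def by blast+
  then show "h \<in> H" by simp
qed

lemma core_normal:
  assumes "subgroup H G"
  shows "core H \<lhd> G"
proof (rule normalI_conj)
  interpret H: subgroup H G by fact
  show "subgroup (core H) G"
  proof (rule subgroupI)
    show "core H \<subseteq> carrier G" by (auto simp: core_def)
    have "\<one> \<in> core H" by (simp add: core_def)
    then show "core H \<noteq> {}" by blast
    show "inv a \<in> core H" if "a \<in> core H" for a
      using that by (simp add: core_def conj_inv)
    show "a \<otimes> b \<in> core H" if "a \<in> core H" "b \<in> core H" for a b
      using that by (simp add: core_def conj_mult)
  qed
  show "g \<otimes> n \<otimes> inv g \<in> core H" if "g \<in> carrier G" "n \<in> core H" for g n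
    using that by (simp add: core_def conj_conj)
qed

lemma normal_subset_core:
  assumes "N \<lhd> G" "N \<subseteq> H"
  shows "N \<subseteq> core H"
  using assms normal_conj_mem[OF assms(1)] subgroup.mem_carrier[OF normal_imp_subgroup[OF assms(1)]]
  unfolding core_def by blast

lemma core_mono: "H \<subseteq> A \<Longrightarrow> core H \<subseteq> core A"
  unfolding core_def by blast

lemma p_part_set_mult_right_trivial:
  assumes "subgroup A G" "subgroup B G" "Factorial_Ring.prime p" "p_part p B = 0"
  shows "p_part p (A <#> B) = p_part p A"
proof -
  have "p_part p (A \<inter> B) \<le> p_part p B"
    using assms(1,2) subgroups_Inter_pair by (intro p_part_mono) auto
  then show ?thesis using p_part_set_mult[OF assms(1-3)] assms(4) by simp
qed

text \<open>Intersecting with \<open>C\<close> cannot create factors \<open>p\<close> in the index: \<open>C\<close> over \<open>K \<inter> C\<close> has the index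
  of \<open>K\<close> in \<open>KC\<close>, which is a subgroup of \<open>A\<close>.\<close>

lemma p_part_Int_eq:
  assumes "subgroup K G" "subgroup C G" "subgroup A G" "K \<subseteq> A" "C \<subseteq> A" and p: "Factorial_Ring.prime p"
    and comm: "K <#> C = C <#> K" and eq: "p_part p K = p_part p A"
  shows "p_part p (K \<inter> C) = p_part p C"
proof -
  have T: "subgroup (K <#> C) G" using subgroup_set_mult assms(1,2) comm by blast
  have "p_part p (K <#> C) \<le> p_part p A"
    using set_mult_subset[OF assms(3-5)] p_part_mono[OF T assms(3)] by blast
  moreover have "p_part p K \<le> p_part p (K <#> C)"
    using p_part_mono[OF assms(1) T subset_set_mult_left[OF assms(2) subgroup.subset[OF assms(1)]]] .
  ultimately show ?thesis using p_part_set_mult[OF assms(1,2) p] eq by simp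
qed

end

section \<open>Conjugation-closed families of projectors\<close>

text \<open>For subgroups \<open>K \<subseteq> L\<close> this says that the index of \<open>K\<close> in \<open>L\<close> is a \<open>\<pi>\<close>-number.  Stating it as an
  equality for each prime makes it transitive at sight and reduces products to arithmetic.\<close>

abbreviation same_index_outside :: "nat set \<Rightarrow> 'a set \<Rightarrow> 'a set \<Rightarrow> bool" where
  "same_index_outside \<pi> K L \<equiv> \<forall>p. Factorial_Ring.prime p \<longrightarrow> p \<notin> \<pi> \<longrightarrow> p_part p K = p_part p L"

text \<open>\<open>Q \<pi>\<close> is to be thought of as the conjugacy class of a projector for the class of \<open>\<pi>\<close>-groups.
  The last axiom is the projector property without quotients: modulo \<open>N\<close>, no \<open>\<pi>\<close>-subgroup
  properly contains the image of \<open>B\<close>.\<close>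

locale projector_family = finite_group +
  fixes \<sigma> :: "nat set set" and Q :: "nat set \<Rightarrow> 'a set set"
  assumes disjoint: "\<pi> \<in> \<sigma> \<Longrightarrow> \<rho> \<in> \<sigma> \<Longrightarrow> \<pi> \<noteq> \<rho> \<Longrightarrow> p \<in> \<pi> \<Longrightarrow> p \<notin> \<rho>"
    and cover: "Factorial_Ring.prime p \<Longrightarrow> \<exists>\<pi>\<in>\<sigma>. p \<in> \<pi>"
    and family_nonempty: "\<pi> \<in> \<sigma> \<Longrightarrow> Q \<pi> \<noteq> {}"
    and family_subgroup: "\<pi> \<in> \<sigma> \<Longrightarrow> B \<in> Q \<pi> \<Longrightarrow> subgroup B G"
    and family_p_part: "\<pi> \<in> \<sigma> \<Longrightarrow> B \<in> Q \<pi> \<Longrightarrow> Factorial_Ring.prime p \<Longrightarrow> p \<notin> \<pi> \<Longrightarrow> p_part p B = 0"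
    and family_conj: "\<pi> \<in> \<sigma> \<Longrightarrow> B \<in> Q \<pi> \<Longrightarrow> g \<in> carrier G \<Longrightarrow> conj_set g B \<in> Q \<pi>"
    and family_maximal: "\<pi> \<in> \<sigma> \<Longrightarrow> B \<in> Q \<pi> \<Longrightarrow> N \<lhd> G \<Longrightarrow> subgroup L G \<Longrightarrow> B <#> N \<subseteq> L \<Longrightarrow>
      same_index_outside \<pi> N L \<Longrightarrow> L \<subseteq> B <#> N"
begin

text \<open>For a class \<open>\<pi>\<close> in \<open>\<sigma>\<close> this turns out to be \<open>O\<^sup>\<pi>(G)\<close>, the smallest normal subgroup with a \<open>\<pi>\<close>-group as quotient: it
  is normal, the next lemmas show that its index is a \<open>\<pi>\<close>-number, and a member of \<open>Q \<rho>\<close> with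
  \<open>\<rho> \<noteq> \<pi>\<close> has trivial image in every quotient that is a \<open>\<pi>\<close>-group.\<close>

definition residual :: "nat set \<Rightarrow> 'a set" where
  "residual \<pi> = generate G (\<Union>\<rho>\<in>\<sigma> - {\<pi>}. \<Union>(Q \<rho>))"

lemma residual_generators: "(\<Union>\<rho>\<in>\<sigma> - {\<pi>}. \<Union>(Q \<rho>)) \<subseteq> carrier G"
proof
  fix b assume "b \<in> (\<Union>\<rho>\<in>\<sigma> - {\<pi>}. \<Union>(Q \<rho>))"
  then obtain \<rho> B where "\<rho> \<in> \<sigma>" "B \<in> Q \<rho>" "b \<in> B" by blast
  then show "b \<in> carrier G" using subgroup.mem_carrier[OF family_subgroup] by blast
qed

lemma subgroup_residual: "subgroup (residual \<pi>) G"
  unfolding residual_def by (rule generate_is_subgroup[OF residual_generators])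

lemma family_subset_residual:
  "\<rho> \<in> \<sigma> \<Longrightarrow> \<rho> \<noteq> \<pi> \<Longrightarrow> B \<in> Q \<rho> \<Longrightarrow> B \<subseteq> residual \<pi>"
  unfolding residual_def using generate.incl[of _ "\<Union>\<rho>\<in>\<sigma> - {\<pi>}. \<Union>(Q \<rho>)"] by blast

lemma residual_subset:
  assumes "subgroup K G" "\<And>\<rho> B. \<rho> \<in> \<sigma> \<Longrightarrow> \<rho> \<noteq> \<pi> \<Longrightarrow> B \<in> Q \<rho> \<Longrightarrow> B \<subseteq> K"
  shows "residual \<pi> \<subseteq> K"
  unfolding residual_def using assms(2) by (intro generate_subgroup_incl[OF _ assms(1)]) blast

lemma residual_normal: "residual \<pi> \<lhd> G"
proof (rule normalI_conj[OF subgroup_residual])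
  fix g n assume g: "g \<in> carrier G" and n: "n \<in> residual \<pi>"
  have "g \<in> normalizer G (residual \<pi>)"
    unfolding residual_def
  proof (rule generate_mem_normalizerI[OF residual_generators g])
    fix x assume "x \<in> (\<Union>\<rho>\<in>\<sigma> - {\<pi>}. \<Union>(Q \<rho>))"
    then obtain \<rho> B where B: "\<rho> \<in> \<sigma> - {\<pi>}" "B \<in> Q \<rho>" "x \<in> B" by blast
    have "conj_set g B \<in> Q \<rho>" using family_conj B(1,2) g by blast
    then show "g \<otimes> x \<otimes> inv g \<in> (\<Union>\<rho>\<in>\<sigma> - {\<pi>}. \<Union>(Q \<rho>))" using B(1,3) by blast
  qed
  then show "g \<otimes> n \<otimes> inv g \<in> residual \<pi>"
    using n mem_normalizer_iff[OF subgroup.subset[OF subgroup_residual]] by blast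
qed

text \<open>Let \<open>\<rho>\<close> be the class of \<open>p\<close>.  The members of \<open>Q \<rho>\<close> are trivial modulo the residual \<open>R\<close>, so by
  maximality \<open>R\<close> is its only overgroup of \<open>\<rho>\<close>-index; adjoining \<open>g\<close> to \<open>R\<close> gives such an overgroup.\<close>

lemma p_element_mem_residual:
  assumes \<pi>: "\<pi> \<in> \<sigma>" and p: "Factorial_Ring.prime p" "p \<notin> \<pi>" and g: "p_element p g"
  shows "g \<in> residual \<pi>"
proof -
  let ?R = "residual \<pi>"
  obtain \<rho> where \<rho>: "\<rho> \<in> \<sigma>" "p \<in> \<rho>" using cover p(1) by blast
  then have ne: "\<rho> \<noteq> \<pi>" using p(2) by blast
  obtain B where B: "B \<in> Q \<rho>" using family_nonempty[OF \<rho>(1)] by blast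
  have BR: "B \<subseteq> ?R" by (rule family_subset_residual[OF \<rho>(1) ne B])
  obtain S k where S: "subgroup S G" "g \<in> S" "card S = p ^ k" using generate_p_element[OF g p(1)] by metis
  have comm: "S <#> ?R = ?R <#> S" by (rule set_mult_commute_normal[OF residual_normal S(1)])
  have L: "subgroup (?R <#> S) G" by (rule subgroup_set_mult[OF subgroup_residual S(1) comm[symmetric]])
  have RL: "?R \<subseteq> ?R <#> S"
    by (rule subset_set_mult_left[OF S(1) subgroup.subset[OF subgroup_residual]])
  have BRR: "B <#> ?R \<subseteq> ?R" by (rule set_mult_subset[OF subgroup_residual BR order_refl])
  have "?R <#> S \<subseteq> B <#> ?R"
  proof (rule family_maximal[OF \<rho>(1) B residual_normal L])
    show "B <#> ?R \<subseteq> ?R <#> S" using BRR RL by (rule subset_trans)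
    show "same_index_outside \<rho> ?R (?R <#> S)"
    proof (intro allI impI)
      fix q :: nat assume q: "Factorial_Ring.prime q" "q \<notin> \<rho>"
      then have "q \<noteq> p" using \<rho>(2) by blast
      then have "p_part q S = 0" using q(1) p(1) S(3) by (simp add: multiplicity_distinct_prime_power)
      then show "p_part q ?R = p_part q (?R <#> S)"
        using p_part_set_mult_right_trivial[OF subgroup_residual S(1) q(1)] by simp
    qed
  qed
  then have "S \<subseteq> ?R"
    using BRR subset_set_mult_right[OF subgroup_residual subgroup.subset[OF S(1)]] by blast
  then show ?thesis using S(2) by blast
qed

lemma family_residual_factorization:
  assumes \<pi>: "\<pi> \<in> \<sigma>" and B: "B \<in> Q \<pi>"
  shows "B <#> residual \<pi> = carrier G"
proof
  have Bs: "subgroup B G" by (rule family_subgroup[OF assms])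
  show "B <#> residual \<pi> \<subseteq> carrier G"
    by (rule set_mult_closed[OF subgroup.subset[OF Bs] subgroup.subset[OF subgroup_residual]])
  have "same_index_outside \<pi> (residual \<pi>) (carrier G)"
    using p_part_eqI_p_elements[OF subgroup_residual subgroup_self subgroup.subset[OF subgroup_residual]]
      p_element_mem_residual[OF \<pi>] by blast
  then show "carrier G \<subseteq> B <#> residual \<pi>"
    using family_maximal[OF assms residual_normal subgroup_self] \<open>B <#> residual \<pi> \<subseteq> carrier G\<close> by blast
qed

lemma family_residual_decompose:
  assumes "\<pi> \<in> \<sigma>" "B \<in> Q \<pi>" "g \<in> carrier G"
  obtains b r where "b \<in> B" "r \<in> residual \<pi>" "g = b \<otimes> r"
proof -
  have "g \<in> B <#> residual \<pi>" using family_residual_factorization[OF assms(1,2)] assms(3) by simp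
  then show ?thesis using that unfolding set_mult_def by blast
qed

section \<open>Subgroups permuting with a projector family\<close>

definition permutable :: "'a set \<Rightarrow> bool" where
  "permutable H \<longleftrightarrow> subgroup H G \<and> (\<forall>\<pi>\<in>\<sigma>. \<forall>B\<in>Q \<pi>. H <#> B = B <#> H)"

lemma permutable_imp_subgroup: "permutable H \<Longrightarrow> subgroup H G"
  by (simp add: permutable_def)

lemma permutable_commute: "permutable H \<Longrightarrow> \<pi> \<in> \<sigma> \<Longrightarrow> B \<in> Q \<pi> \<Longrightarrow> H <#> B = B <#> H"
  by (simp add: permutable_def)

lemma subgroup_permutable_product:
  "permutable H \<Longrightarrow> \<pi> \<in> \<sigma> \<Longrightarrow> B \<in> Q \<pi> \<Longrightarrow> subgroup (H <#> B) G"
  by (intro subgroup_set_mult permutable_imp_subgroup family_subgroup permutable_commute)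

lemma permutable_subset_product:
  assumes "permutable H" "\<pi> \<in> \<sigma>" "B \<in> Q \<pi>"
  shows "H \<subseteq> H <#> B" "B \<subseteq> H <#> B"
proof -
  show "H \<subseteq> H <#> B"
    by (rule subset_set_mult_left[OF family_subgroup[OF assms(2,3)] subgroup.subset[OF permutable_imp_subgroup[OF assms(1)]]])
  show "B \<subseteq> H <#> B"
    by (rule subset_set_mult_right[OF permutable_imp_subgroup[OF assms(1)] subgroup.subset[OF family_subgroup[OF assms(2,3)]]])
qed

lemma same_index_outside_of_product:
  assumes H: "permutable H" and B: "\<pi> \<in> \<sigma>" "B \<in> Q \<pi>"
    and M: "subgroup M G" "H \<subseteq> M" "M \<subseteq> H <#> B"
  shows "same_index_outside \<pi> H M"
proof (intro allI impI)
  fix p :: nat assume p: "Factorial_Ring.prime p" "p \<notin> \<pi>"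
  have "p_part p H \<le> p_part p M" by (rule p_part_mono[OF permutable_imp_subgroup[OF H] M(1,2)])
  moreover have "p_part p M \<le> p_part p (H <#> B)"
    by (rule p_part_mono[OF M(1) subgroup_permutable_product[OF H B] M(3)])
  moreover have "p_part p (H <#> B) = p_part p H"
    by (rule p_part_set_mult_right_trivial[OF permutable_imp_subgroup[OF H] family_subgroup[OF B] p(1) family_p_part[OF B p]])
  ultimately show "p_part p H = p_part p M" by simp
qed

lemma permutable_conj_set:
  assumes H: "permutable H" and g: "g \<in> carrier G"
  shows "permutable (conj_set g H)"
  unfolding permutable_def
proof (intro conjI ballI)
  show sub: "subgroup (conj_set g H) G" by (rule subgroup_conj_set[OF permutable_imp_subgroup[OF H] g])
  fix \<pi> B assume B: "\<pi> \<in> \<sigma>" "B \<in> Q \<pi>"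
  note Bs = family_subgroup[OF B]
  show "conj_set g H <#> B = B <#> conj_set g H"
  proof (rule set_mult_commuteI[OF sub Bs])
    fix a b assume a: "a \<in> conj_set g H" and b: "b \<in> B"
    obtain h where h: "h \<in> H" "a = g \<otimes> h \<otimes> inv g" using a by blast
    let ?B = "conj_set (inv g) B"
    have B': "?B \<in> Q \<pi>" using family_conj[OF B inv_closed[OF g]] .
    have "inv g \<otimes> b \<otimes> inv (inv g) \<in> ?B" using b by (rule imageI)
    then obtain c' h' where e: "c' \<in> ?B" "h' \<in> H" "h \<otimes> (inv g \<otimes> b \<otimes> inv (inv g)) = c' \<otimes> h'"
      using set_mult_exchange[OF permutable_commute[OF H B(1) B'] h(1)] by blast
    obtain c where c: "c' = inv g \<otimes> c \<otimes> inv (inv g)" "c \<in> B" using e(1) by (rule imageE)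
    have m: "h \<in> carrier G" "h' \<in> carrier G" "b \<in> carrier G" "c \<in> carrier G"
      using h(1) e(2) b c(2) subgroup.mem_carrier[OF permutable_imp_subgroup[OF H]] subgroup.mem_carrier[OF Bs] by auto
    have "a \<otimes> b = g \<otimes> (h \<otimes> (inv g \<otimes> b \<otimes> inv (inv g))) \<otimes> inv g"
      using m g h(2) by (simp add: m_assoc)
    also have "\<dots> = c \<otimes> (g \<otimes> h' \<otimes> inv g)"
      unfolding e(3) c(1) using m g by (simp add: m_assoc)
    finally show "a \<otimes> b \<in> B <#> conj_set g H"
      using set_multI[OF c(2) imageI[OF e(2)]] by simp
  qed
qed

lemma permutable_generate:
  assumes H: "permutable H" and K: "permutable K"
  shows "permutable (generate G (H \<union> K))"
  unfolding permutable_def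
proof (intro conjI ballI)
  let ?A = "generate G (H \<union> K)"
  have HK: "H \<union> K \<subseteq> carrier G"
    using subgroup.subset[OF permutable_imp_subgroup[OF H]] subgroup.subset[OF permutable_imp_subgroup[OF K]] by blast
  show sub: "subgroup ?A G" by (rule generate_is_subgroup[OF HK])
  fix \<pi> B assume B: "\<pi> \<in> \<sigma>" "B \<in> Q \<pi>"
  note Bs = family_subgroup[OF B]
  have gen: "x \<otimes> b \<in> B <#> ?A" if x: "x \<in> H \<union> K" and b: "b \<in> B" for x b
  proof -
    have HA: "H \<subseteq> ?A" "K \<subseteq> ?A" by (auto intro: generate.incl)
    have "\<exists>X. permutable X \<and> x \<in> X \<and> X \<subseteq> ?A"
    proof (cases "x \<in> H")
      case True
      then show ?thesis using H HA(1) by (intro exI[of _ H]) simp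
    next
      case False
      then show ?thesis using x K HA(2) by (intro exI[of _ K]) simp
    qed
    then obtain X where X: "permutable X" "x \<in> X" "X \<subseteq> ?A" by blast
    obtain b' x' where "b' \<in> B" "x' \<in> X" "x \<otimes> b = b' \<otimes> x'"
      using set_mult_exchange[OF permutable_commute[OF X(1) B] X(2) b] by blast
    then show ?thesis using set_multI[of b' B x' ?A] X(3) by auto
  qed
  show "?A <#> B = B <#> ?A"
  proof (rule set_mult_commuteI[OF sub Bs])
    fix a b assume "a \<in> ?A" "b \<in> B"
    then show "a \<otimes> b \<in> B <#> ?A"
    proof (induction a arbitrary: b rule: generate.induct)
      case one
      then show ?case using set_multI[OF one generate.one[of G "H \<union> K"]] subgroup.mem_carrier[OF Bs one] by simp
    next
      case (incl h)
      then show ?case by (rule gen)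
    next
      case (inv h)
      have "inv h \<in> H \<union> K"
        using inv(1) subgroup.m_inv_closed[OF permutable_imp_subgroup[OF H]] subgroup.m_inv_closed[OF permutable_imp_subgroup[OF K]] by blast
      then show ?case using inv(2) by (rule gen)
    next
      case (eng x y)
      obtain b' y' where e: "b' \<in> B" "y' \<in> ?A" "y \<otimes> b = b' \<otimes> y'"
        using eng.IH(2)[OF eng.prems] unfolding set_mult_def by blast
      obtain b'' x' where f: "b'' \<in> B" "x' \<in> ?A" "x \<otimes> b' = b'' \<otimes> x'"
        using eng.IH(1)[OF e(1)] unfolding set_mult_def by blast
      have m: "x \<in> carrier G" "y \<in> carrier G" "b \<in> carrier G" "b' \<in> carrier G" "b'' \<in> carrier G" "x' \<in> carrier G" "y' \<in> carrier G"
        using eng.hyps eng.prems e(1,2) f(1,2) subgroup.mem_carrier[OF sub] subgroup.mem_carrier[OF Bs] by auto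
      have "x \<otimes> y \<otimes> b = x \<otimes> b' \<otimes> y'" using m e(3) by (simp add: m_assoc)
      also have "\<dots> = b'' \<otimes> (x' \<otimes> y')" unfolding f(3) using m by (simp add: m_assoc)
      finally show ?case using set_multI[OF f(1) subgroup.m_closed[OF sub f(2) e(2)]] by simp
    qed
  qed
qed

text \<open>The index of \<open>H\<close> in the intersection is a \<open>\<pi>\<close>-number because of \<open>A\<close> and a \<open>\<rho>\<close>-number
  because of \<open>HB\<close>, hence \<open>1\<close>.\<close>

lemma permutable_product_Int:
  assumes H: "permutable H" and A: "subgroup A G" "H \<subseteq> A" "same_index_outside \<pi> H A"
    and \<rho>: "\<pi> \<in> \<sigma>" "\<rho> \<in> \<sigma>" "\<rho> \<noteq> \<pi>" "B \<in> Q \<rho>"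
  shows "(H <#> B) \<inter> A = H"
proof -
  have M: "subgroup ((H <#> B) \<inter> A) G"
    by (rule subgroups_Inter_pair[OF subgroup_permutable_product[OF H \<rho>(2,4)] A(1)])
  have HM: "H \<subseteq> (H <#> B) \<inter> A" using permutable_subset_product[OF H \<rho>(2,4)] A(2) by blast
  have "H = (H <#> B) \<inter> A"
  proof (rule subgroup_eqI_p_part[OF permutable_imp_subgroup[OF H] M HM])
    fix p :: nat assume p: "Factorial_Ring.prime p"
    show "p_part p H = p_part p ((H <#> B) \<inter> A)"
    proof (cases "p \<in> \<pi>")
      case True
      then have "p \<notin> \<rho>" using disjoint[OF \<rho>(1,2)] \<rho>(3) by blast
      then show ?thesis using same_index_outside_of_product[OF H \<rho>(2,4) M HM] p by blast
    next
      case False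
      then have "p_part p H = p_part p A" using A(3) p by blast
      moreover have "p_part p H \<le> p_part p ((H <#> B) \<inter> A)"
        by (rule p_part_mono[OF permutable_imp_subgroup[OF H] M HM])
      moreover have "p_part p ((H <#> B) \<inter> A) \<le> p_part p A" by (rule p_part_mono[OF M A(1)]) simp
      ultimately show ?thesis by simp
    qed
  qed
  then show ?thesis by simp
qed

text \<open>For a subgroup \<open>H\<close> and a class \<open>\<pi>\<close> in \<open>\<sigma>\<close> this is, modulo the core of \<open>H\<close>, the largest normal
  \<open>\<pi>\<close>-subgroup, written as the intersection of the images of the members of \<open>Q \<pi>\<close>.\<close>

definition radical_over_core :: "nat set \<Rightarrow> 'a set \<Rightarrow> 'a set" where
  "radical_over_core \<pi> H = (\<Inter>B\<in>Q \<pi>. core H <#> B)"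

lemma radical_normal:
  assumes H: "subgroup H G" and \<pi>: "\<pi> \<in> \<sigma>"
  shows "radical_over_core \<pi> H \<lhd> G"
  unfolding radical_over_core_def
proof (rule normalI_conj)
  have "subgroup (\<Inter>((\<lambda>B. core H <#> B) ` Q \<pi>)) G"
  proof (rule subgroups_Inter)
    show "(\<lambda>B. core H <#> B) ` Q \<pi> \<noteq> {}" using family_nonempty[OF \<pi>] by blast
    show "subgroup L G" if "L \<in> (\<lambda>B. core H <#> B) ` Q \<pi>" for L
      using that subgroup_normal_set_mult[OF core_normal[OF H] family_subgroup[OF \<pi>]] by blast
  qed
  then show "subgroup (\<Inter>B\<in>Q \<pi>. core H <#> B) G" .
next
  fix g n assume g: "g \<in> carrier G" and n: "n \<in> (\<Inter>B\<in>Q \<pi>. core H <#> B)"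
  show "g \<otimes> n \<otimes> inv g \<in> (\<Inter>B\<in>Q \<pi>. core H <#> B)"
  proof (rule INT_I)
    fix B assume B: "B \<in> Q \<pi>"
    have "n \<in> core H <#> conj_set (inv g) B" using n family_conj[OF \<pi> B inv_closed[OF g]] by blast
    then obtain c b where cb: "c \<in> core H" "b \<in> B" "n = c \<otimes> (inv g \<otimes> b \<otimes> inv (inv g))"
      unfolding set_mult_def by blast
    have m: "c \<in> carrier G" "b \<in> carrier G"
      using cb(1,2) subgroup.mem_carrier[OF family_subgroup[OF \<pi> B]]
        subgroup.mem_carrier[OF normal_imp_subgroup[OF core_normal[OF H]]] by auto
    have "g \<otimes> n \<otimes> inv g = (g \<otimes> c \<otimes> inv g) \<otimes> b" using m g cb(3) by (simp add: m_assoc)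
    then show "g \<otimes> n \<otimes> inv g \<in> core H <#> B"
      using set_multI[OF normal_conj_mem[OF core_normal[OF H] g cb(1)] cb(2)] by simp
  qed
qed

lemma core_subset_radical:
  assumes H: "subgroup H G" and \<pi>: "\<pi> \<in> \<sigma>"
  shows "core H \<subseteq> radical_over_core \<pi> H"
  unfolding radical_over_core_def
  using subset_set_mult_left[OF family_subgroup[OF \<pi>] subgroup.subset[OF normal_imp_subgroup[OF core_normal[OF H]]]] by blast

lemma same_index_outside_core_radical:
  assumes H: "subgroup H G" and \<pi>: "\<pi> \<in> \<sigma>"
  shows "same_index_outside \<pi> (core H) (radical_over_core \<pi> H)"
proof (intro allI impI)
  fix p :: nat assume p: "Factorial_Ring.prime p" "p \<notin> \<pi>"
  obtain B where B: "B \<in> Q \<pi>" using family_nonempty[OF \<pi>] by blast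
  note D = core_normal[OF H]
  note Ds = normal_imp_subgroup[OF D]
  note Os = normal_imp_subgroup[OF radical_normal[OF H \<pi>]]
  have "p_part p (core H) \<le> p_part p (radical_over_core \<pi> H)"
    by (rule p_part_mono[OF Ds Os core_subset_radical[OF H \<pi>]])
  moreover have "p_part p (radical_over_core \<pi> H) \<le> p_part p (core H <#> B)"
    using B unfolding radical_over_core_def[of \<pi> H]
    by (intro p_part_mono[OF Os[unfolded radical_over_core_def] subgroup_normal_set_mult[OF D family_subgroup[OF \<pi> B]]]) blast
  moreover have "p_part p (core H <#> B) = p_part p (core H)"
    by (rule p_part_set_mult_right_trivial[OF Ds family_subgroup[OF \<pi> B] p(1) family_p_part[OF \<pi> B p]])
  ultimately show "p_part p (core H) = p_part p (radical_over_core \<pi> H)" by simp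
qed

text \<open>Again two indices meet: over \<open>H \<inter> O\<close>, where \<open>O\<close> is the radical, the group \<open>HB \<inter> O\<close> has
  \<open>\<pi>\<close>-index since \<open>O\<close> is a \<open>\<pi>\<close>-group modulo the core, and \<open>\<rho>\<close>-index since \<open>H\<close> has \<open>\<rho>\<close>-index in \<open>HB\<close>.\<close>

lemma product_Int_radical:
  assumes H: "permutable H" and \<pi>: "\<pi> \<in> \<sigma>" "\<rho> \<in> \<sigma>" "\<rho> \<noteq> \<pi>" and B: "B \<in> Q \<rho>"
  shows "(H <#> B) \<inter> radical_over_core \<pi> H = H \<inter> radical_over_core \<pi> H"
proof -
  let ?O = "radical_over_core \<pi> H" and ?T = "H <#> B"
  note Hs = permutable_imp_subgroup[OF H]
  note O = radical_normal[OF Hs \<pi>(1)]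
  note Os = normal_imp_subgroup[OF O]
  note Ts = subgroup_permutable_product[OF H \<pi>(2) B]
  note HT = permutable_subset_product(1)[OF H \<pi>(2) B]
  have K: "subgroup (H \<inter> ?O) G" by (rule subgroups_Inter_pair[OF Hs Os])
  have M: "subgroup (?T \<inter> ?O) G" by (rule subgroups_Inter_pair[OF Ts Os])
  have KM: "H \<inter> ?O \<subseteq> ?T \<inter> ?O" using HT by blast
  have "H \<inter> ?O = ?T \<inter> ?O"
  proof (rule subgroup_eqI_p_part[OF K M KM])
    fix p :: nat assume p: "Factorial_Ring.prime p"
    show "p_part p (H \<inter> ?O) = p_part p (?T \<inter> ?O)"
    proof (cases "p \<in> \<pi>")
      case True
      then have p': "p \<notin> \<rho>" using disjoint[OF \<pi>(1,2)] \<pi>(3) by blast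
      have "H \<subseteq> normalizer G (?T \<inter> ?O)"
      proof
        fix h assume h: "h \<in> H"
        have hc: "h \<in> carrier G" by (rule subgroup.mem_carrier[OF Hs h])
        have "h \<otimes> k \<otimes> inv h \<in> ?T \<inter> ?O" if "k \<in> ?T \<inter> ?O" for k
          using that subgroup_conj_mem[OF Ts subsetD[OF HT h]] normal_conj_mem[OF O hc] by blast
        then show "h \<in> normalizer G (?T \<inter> ?O)"
          using mem_normalizer_iff[OF subgroup.subset[OF M]] hc by blast
      qed
      then have comm: "H <#> (?T \<inter> ?O) = (?T \<inter> ?O) <#> H" by (rule set_mult_commute_normalizer[OF M Hs])
      have eq: "p_part p H = p_part p ?T" using same_index_outside_of_product[OF H \<pi>(2) B Ts HT order_refl] p p' by blast
      have "p_part p (H \<inter> (?T \<inter> ?O)) = p_part p (?T \<inter> ?O)"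
        by (rule p_part_Int_eq[OF Hs M Ts HT _ p comm eq]) blast
      moreover have "H \<inter> (?T \<inter> ?O) = H \<inter> ?O" using HT by blast
      ultimately show ?thesis by simp
    next
      case False
      have "p_part p (core H) \<le> p_part p (H \<inter> ?O)"
        using core_subset core_subset_radical[OF Hs \<pi>(1)]
        by (intro p_part_mono[OF normal_imp_subgroup[OF core_normal[OF Hs]] K]) blast
      moreover have "p_part p (H \<inter> ?O) \<le> p_part p (?T \<inter> ?O)" by (rule p_part_mono[OF K M KM])
      moreover have "p_part p (?T \<inter> ?O) \<le> p_part p ?O" by (rule p_part_mono[OF M Os]) blast
      moreover have "p_part p (core H) = p_part p ?O"
        using same_index_outside_core_radical[OF Hs \<pi>(1)] p False by blast
      ultimately show ?thesis by simp
    qed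
  qed
  then show ?thesis by simp
qed

lemma family_subset_normalizer_radical_Int:
  assumes H: "permutable H" and \<pi>: "\<pi> \<in> \<sigma>" "\<rho> \<in> \<sigma>" "\<rho> \<noteq> \<pi>" and B: "B \<in> Q \<rho>"
  shows "B \<subseteq> normalizer G (H \<inter> radical_over_core \<pi> H)"
proof
  let ?O = "radical_over_core \<pi> H" and ?T = "H <#> B"
  note Hs = permutable_imp_subgroup[OF H]
  note O = radical_normal[OF Hs \<pi>(1)]
  note Ts = subgroup_permutable_product[OF H \<pi>(2) B]
  have Kc: "H \<inter> ?O \<subseteq> carrier G" using subgroup.subset[OF Hs] by blast
  fix b assume b: "b \<in> B"
  have bT: "b \<in> ?T" using permutable_subset_product(2)[OF H \<pi>(2) B] b by blast
  have bc: "b \<in> carrier G" by (rule subgroup.mem_carrier[OF Ts bT])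
  have "b \<otimes> k \<otimes> inv b \<in> H \<inter> ?O" if "k \<in> H \<inter> ?O" for k
    using that subgroup_conj_mem[OF Ts bT] normal_conj_mem[OF O bc]
    unfolding product_Int_radical[OF assms, symmetric] by blast
  then show "b \<in> normalizer G (H \<inter> ?O)" using mem_normalizer_iff[OF Kc] bc by blast
qed

lemma residual_subset_normalizer_radical_Int:
  assumes H: "permutable H" and \<pi>: "\<pi> \<in> \<sigma>"
  shows "residual \<pi> \<subseteq> normalizer G (H \<inter> radical_over_core \<pi> H)"
proof (rule residual_subset)
  show "subgroup (normalizer G (H \<inter> radical_over_core \<pi> H)) G"
    using subgroup.subset[OF permutable_imp_subgroup[OF H]] by (intro subgroup_normalizer) blast
qed (rule family_subset_normalizer_radical_Int[OF H \<pi>])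

section \<open>Primary elements of a permutable subgroup\<close>

text \<open>For a subgroup \<open>H\<close> this expresses, without quotients, that \<open>H\<close> modulo its core lies in the direct
  product, over all classes \<open>\<pi>\<close>, of the largest normal \<open>\<pi>\<close>-subgroups of \<open>G\<close> modulo \<open>core H\<close>.\<close>

definition primary_elements_in_radicals :: "'a set \<Rightarrow> bool" where
  "primary_elements_in_radicals H \<longleftrightarrow>
    (\<forall>\<pi>\<in>\<sigma>. \<forall>p h. Factorial_Ring.prime p \<longrightarrow> p \<in> \<pi> \<longrightarrow> h \<in> H \<longrightarrow> p_element p h \<longrightarrow> h \<in> radical_over_core \<pi> H)"

text \<open>For a generator \<open>B\<close> of the residual, \<open>HB\<close> normalizes its intersection with the normal subgroup
  \<open>core A\<close>, and this intersection is \<open>H \<inter> core A\<close> because \<open>HB \<inter> A = H\<close>.\<close>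

lemma residual_subset_normalizer_core_Int:
  assumes H: "permutable H" and A: "subgroup A G" "H \<subseteq> A" "same_index_outside \<pi> H A" and \<pi>: "\<pi> \<in> \<sigma>"
  shows "residual \<pi> \<subseteq> normalizer G (H \<inter> core A)"
proof (rule residual_subset)
  note Hs = permutable_imp_subgroup[OF H]
  have Kc: "H \<inter> core A \<subseteq> carrier G" using subgroup.subset[OF Hs] by blast
  show "subgroup (normalizer G (H \<inter> core A)) G" by (rule subgroup_normalizer[OF Kc])
  fix \<rho> B assume \<rho>: "\<rho> \<in> \<sigma>" "\<rho> \<noteq> \<pi>" "B \<in> Q \<rho>"
  note Ts = subgroup_permutable_product[OF H \<rho>(1,3)]
  have TA: "(H <#> B) \<inter> A = H" by (rule permutable_product_Int[OF H A \<pi> \<rho>])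
  show "B \<subseteq> normalizer G (H \<inter> core A)"
  proof
    fix b assume "b \<in> B"
    then have bT: "b \<in> H <#> B" using permutable_subset_product(2)[OF H \<rho>(1,3)] by (rule subsetD[rotated])
    have bc: "b \<in> carrier G" by (rule subgroup.mem_carrier[OF Ts bT])
    have "b \<otimes> k \<otimes> inv b \<in> H \<inter> core A" if k: "k \<in> H \<inter> core A" for k
    proof -
      have kT: "k \<in> H <#> B" using k permutable_subset_product(1)[OF H \<rho>(1,3)] by blast
      have "b \<otimes> k \<otimes> inv b \<in> H <#> B" by (rule subgroup_conj_mem[OF Ts bT kT])
      moreover have "b \<otimes> k \<otimes> inv b \<in> core A" using k normal_conj_mem[OF core_normal[OF A(1)] bc] by blast
      ultimately show ?thesis using TA core_subset[of A] by blast
    qed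
    then show "b \<in> normalizer G (H \<inter> core A)" using mem_normalizer_iff[OF Kc] bc by blast
  qed
qed

text \<open>A \<open>p\<close>-element of \<open>core A\<close> with \<open>p \<notin> \<pi>\<close> lies in the residual, hence normalizes \<open>H \<inter> core A\<close>, and
  this has \<open>\<pi>\<close>-index in \<open>core A\<close>; so the element lies in \<open>H\<close>.  The same is true of its conjugates,
  which puts it into \<open>core H\<close>.\<close>

lemma same_index_outside_cores:
  assumes H: "permutable H" and A: "subgroup A G" "H \<subseteq> A" "same_index_outside \<pi> H A" and \<pi>: "\<pi> \<in> \<sigma>"
  shows "same_index_outside \<pi> (core H) (core A)"
proof (intro allI impI)
  fix p :: nat assume p: "Factorial_Ring.prime p" "p \<notin> \<pi>"
  note Hs = permutable_imp_subgroup[OF H]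
  note C = core_normal[OF A(1)]
  note Cs = normal_imp_subgroup[OF C]
  note Ds = normal_imp_subgroup[OF core_normal[OF Hs]]
  have K: "subgroup (H \<inter> core A) G" by (rule subgroups_Inter_pair[OF Hs Cs])
  have eqA: "p_part p H = p_part p A" using A(3) p by blast
  have eq: "p_part p (H \<inter> core A) = p_part p (core A)"
    by (rule p_part_Int_eq[OF Hs Cs A(1,2) core_subset p(1) set_mult_commute_normal[OF C Hs] eqA])
  have inH: "c \<in> H" if c: "c \<in> core A" "p_element p c" for c
  proof -
    have "c \<in> normalizer G (H \<inter> core A)"
      using p_element_mem_residual[OF \<pi> p c(2)] residual_subset_normalizer_core_Int[OF assms] by blast
    then show ?thesis using p_element_mem_of_p_part_eq[OF K Cs Int_lower2 p(1) eq c] by blast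
  qed
  show "p_part p (core H) = p_part p (core A)"
  proof (rule p_part_eqI_p_elements[OF Ds Cs core_mono[OF A(2)] p(1)])
    fix c assume c: "c \<in> core A" "p_element p c"
    have "g \<otimes> c \<otimes> inv g \<in> H" if g: "g \<in> carrier G" for g
      using normal_conj_mem[OF C g c(1)] p_element_conj[OF c(2) g] by (rule inH)
    then show "c \<in> core H" using subgroup.mem_carrier[OF Cs c(1)] by (simp add: core_def)
  qed
qed

text \<open>Put \<open>C = core A\<close> and \<open>D = core H\<close>, so \<open>C\<close> is a \<open>\<pi>\<close>-group modulo \<open>D\<close>, and let \<open>h\<close> be a \<open>p\<close>-element of
  \<open>H\<close> with \<open>p \<in> \<rho>\<close>.  It lies in \<open>CB\<close> for \<open>B \<in> Q \<rho>\<close>, and the task is to replace \<open>C\<close> by \<open>D\<close>.  If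
  \<open>\<rho> = \<pi>\<close>, then \<open>CB\<close> is a \<open>\<pi>\<close>-group modulo \<open>D\<close>, so maximality gives \<open>CB = DB\<close>.

  If \<open>\<rho> \<noteq> \<pi>\<close>, let \<open>L\<close> be the part of \<open>A\<close> in its \<open>\<rho>\<close>-radical and \<open>W\<close> the group generated by the
  intersections of the members of \<open>Q \<rho>\<close> with \<open>L\<close>.  Then \<open>W\<close> lies in \<open>H\<close> and \<open>L = CW\<close>.  The decisive
  point is \<open>W \<inter> C \<subseteq> D\<close>: it makes \<open>DW\<close> a subgroup of \<open>\<pi>\<close>-index in \<open>L\<close>, so that \<open>h \<in> DW\<close>, and it also
  shows \<open>W \<subseteq> DB\<close>.\<close>

lemma primary_elements_in_radicals_step:
  assumes H: "permutable H" and A: "permutable A" "H \<subseteq> A" "same_index_outside \<pi> H A" and \<pi>: "\<pi> \<in> \<sigma>"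
    and IH: "primary_elements_in_radicals A"
  shows "primary_elements_in_radicals H"
  unfolding primary_elements_in_radicals_def
proof (intro ballI allI impI)
  fix \<rho> p h
  assume \<rho>: "\<rho> \<in> \<sigma>" and p: "Factorial_Ring.prime p" "p \<in> \<rho>" and h: "h \<in> H" "p_element p h"
  define C D where "C = core A" and "D = core H"
  note Hs = permutable_imp_subgroup[OF H]
  note As = permutable_imp_subgroup[OF A(1)]
  have C: "C \<lhd> G" unfolding C_def by (rule core_normal[OF As])
  have D: "D \<lhd> G" unfolding D_def by (rule core_normal[OF Hs])
  note Cs = normal_imp_subgroup[OF C]
  note Ds = normal_imp_subgroup[OF D]
  have DC: "D \<subseteq> C" unfolding C_def D_def by (rule core_mono[OF A(2)])
  have CA: "C \<subseteq> A" unfolding C_def by (rule core_subset)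
  have idx: "same_index_outside \<pi> D C"
    unfolding C_def D_def by (rule same_index_outside_cores[OF H As A(2,3) \<pi>])
  have hO: "h \<in> radical_over_core \<rho> A"
    using IH \<rho> p h A(2) unfolding primary_elements_in_radicals_def by blast
  have "h \<in> D <#> B" if B: "B \<in> Q \<rho>" for B
  proof (cases "\<rho> = \<pi>")
    case True
    note Bs = family_subgroup[OF \<rho> B]
    have comm: "D <#> B = B <#> D" using set_mult_commute_normal[OF D Bs] by simp
    have "C <#> B \<subseteq> B <#> D"
    proof (rule family_maximal[OF \<rho> B D subgroup_normal_set_mult[OF C Bs]])
      show "B <#> D \<subseteq> C <#> B" unfolding comm[symmetric] by (rule mono_set_mult[OF DC order_refl])
      show "same_index_outside \<rho> D (C <#> B)"
        using idx p_part_set_mult_right_trivial[OF Cs Bs] family_p_part[OF \<rho> B] True by metis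
    qed
    then show ?thesis using hO B comm unfolding radical_over_core_def C_def by blast
  next
    case False
    note Bs = family_subgroup[OF \<rho> B]
    define L where "L = A \<inter> radical_over_core \<rho> A"
    have O: "radical_over_core \<rho> A \<lhd> G" by (rule radical_normal[OF As \<rho>])
    have Ls: "subgroup L G" unfolding L_def by (rule subgroups_Inter_pair[OF As normal_imp_subgroup[OF O]])
    have CL: "C \<subseteq> L" using CA core_subset_radical[OF As \<rho>] unfolding L_def C_def by blast
    have hL: "h \<in> L" using h(1) A(2) hO unfolding L_def by blast
    define W where "W = generate G (\<Union>B\<in>Q \<rho>. B \<inter> L)"
    have gens: "(\<Union>B\<in>Q \<rho>. B \<inter> L) \<subseteq> L" by blast
    have gensc: "(\<Union>B\<in>Q \<rho>. B \<inter> L) \<subseteq> carrier G" using gens subgroup.subset[OF Ls] by (rule subset_trans)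
    have Ws: "subgroup W G" unfolding W_def by (rule generate_is_subgroup[OF gensc])
    have WL: "W \<subseteq> L" unfolding W_def by (rule generate_subgroup_incl[OF gens Ls])
    \<comment> \<open>Each \<open>B' \<inter> A\<close> with \<open>B' \<in> Q \<rho>\<close> lies in \<open>HB' \<inter> A\<close>, which is \<open>H\<close>.\<close>
    have WH: "W \<subseteq> H"
      unfolding W_def
    proof (rule generate_subgroup_incl[OF _ Hs], rule UN_least)
      fix B' assume B': "B' \<in> Q \<rho>"
      have "(H <#> B') \<inter> A = H" by (rule permutable_product_Int[OF H As A(2,3) \<pi> \<rho> False B'])
      then show "B' \<inter> L \<subseteq> H" using permutable_subset_product(2)[OF H \<rho> B'] unfolding L_def by blast
    qed
    have BLW: "B \<inter> L \<subseteq> W" unfolding W_def using B generate.incl[of _ "\<Union>B\<in>Q \<rho>. B \<inter> L" G] by blast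
    \<comment> \<open>\<open>W\<close> depends only on \<open>L\<close> and the conjugation-closed family \<open>Q \<rho>\<close>.\<close>
    have nrmW: "g \<in> normalizer G W" if g: "g \<in> normalizer G L" for g
      unfolding W_def
    proof (rule generate_mem_normalizerI[OF gensc])
      show gc: "g \<in> carrier G" using g mem_normalizer_iff[OF subgroup.subset[OF Ls]] by blast
      fix x assume "x \<in> (\<Union>B\<in>Q \<rho>. B \<inter> L)"
      then obtain B' where B': "B' \<in> Q \<rho>" "x \<in> B'" "x \<in> L" by blast
      have "g \<otimes> x \<otimes> inv g \<in> conj_set g B'" using B'(2) by (rule imageI)
      moreover have "g \<otimes> x \<otimes> inv g \<in> L" using g B'(3) mem_normalizer_iff[OF subgroup.subset[OF Ls]] by blast
      ultimately show "g \<otimes> x \<otimes> inv g \<in> (\<Union>B\<in>Q \<rho>. B \<inter> L)" using family_conj[OF \<rho> B'(1) gc] by blast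
    qed
    have RW: "residual \<rho> \<subseteq> normalizer G W"
      using residual_subset_normalizer_radical_Int[OF A(1) \<rho>] nrmW unfolding L_def by blast
    \<comment> \<open>Write a conjugating element as \<open>br\<close> with \<open>r\<close> in the \<open>\<rho>\<close>-residual.  Conjugation by \<open>r\<close> preserves
      \<open>W\<close>, conjugation by \<open>b\<close> stays in \<open>HB\<close>, and \<open>C\<close> is normal, so the result lies in \<open>HB \<inter> A = H\<close>.\<close>
    have WC: "W \<inter> C \<subseteq> D"
    proof
      fix w assume w: "w \<in> W \<inter> C"
      have "g \<otimes> w \<otimes> inv g \<in> H" if g: "g \<in> carrier G" for g
      proof -
        obtain b r where br: "b \<in> B" "r \<in> residual \<rho>" "g = b \<otimes> r"
          using family_residual_decompose[OF \<rho> B g] by blast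
        have m: "b \<in> carrier G" "r \<in> carrier G" "w \<in> carrier G"
          using br(1,2) w subgroup.mem_carrier[OF Bs] subgroup.mem_carrier[OF subgroup_residual] subgroup.mem_carrier[OF Cs] by auto
        have T: "subgroup (H <#> B) G" by (rule subgroup_permutable_product[OF H \<rho> B])
        have "r \<otimes> w \<otimes> inv r \<in> W"
          using RW br(2) w mem_normalizer_iff[OF subgroup.subset[OF Ws]] by blast
        then have 1: "r \<otimes> w \<otimes> inv r \<in> H <#> B" using WH permutable_subset_product(1)[OF H \<rho> B] by blast
        have "b \<in> H <#> B" using br(1) permutable_subset_product(2)[OF H \<rho> B] by blast
        then have "b \<otimes> (r \<otimes> w \<otimes> inv r) \<otimes> inv b \<in> H <#> B" using 1 by (rule subgroup_conj_mem[OF T])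
        then have "g \<otimes> w \<otimes> inv g \<in> H <#> B" unfolding br(3) using conj_conj[OF m] by simp
        moreover have "g \<otimes> w \<otimes> inv g \<in> A" using normal_conj_mem[OF C g] w CA by blast
        ultimately show ?thesis using permutable_product_Int[OF H As A(2,3) \<pi> \<rho> False B] by blast
      qed
      then show "w \<in> D" unfolding D_def core_def using subgroup.mem_carrier[OF Ws] w by blast
    qed
    \<comment> \<open>By definition of the radical \<open>L \<subseteq> CB\<close>, and \<open>C \<subseteq> L\<close>, so the modular law applies.\<close>
    have LCX: "\<exists>c x. c \<in> C \<and> x \<in> B \<inter> L \<and> l = c \<otimes> x" if l: "l \<in> L" for l
    proof -
      have "l \<in> C <#> B" using l B unfolding L_def radical_over_core_def C_def by blast
      then obtain c b where cb: "c \<in> C" "b \<in> B" "l = c \<otimes> b" unfolding set_mult_def by blast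
      have cL: "c \<in> L" using CL cb(1) by blast
      have "inv c \<otimes> l \<in> L" by (rule subgroup.m_closed[OF Ls subgroup.m_inv_closed[OF Ls cL] l])
      moreover have "inv c \<otimes> l = b"
        unfolding cb(3) using subgroup.mem_carrier[OF Cs cb(1)] subgroup.mem_carrier[OF Bs cb(2)] by simp
      ultimately show ?thesis using cb by (intro exI[of _ c] exI[of _ b]) simp
    qed
    have CWL: "C <#> W = L"
    proof
      show "C <#> W \<subseteq> L" by (rule set_mult_subset[OF Ls CL WL])
      show "L \<subseteq> C <#> W"
      proof
        fix l assume "l \<in> L"
        then obtain c x where cx: "c \<in> C" "x \<in> B \<inter> L" "l = c \<otimes> x" using LCX by blast
        show "l \<in> C <#> W" unfolding cx(3) by (rule set_multI[OF cx(1) subsetD[OF BLW cx(2)]])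
      qed
    qed
    have DWs: "subgroup (D <#> W) G" by (rule subgroup_normal_set_mult[OF D Ws])
    have DWL: "D <#> W \<subseteq> L" using set_mult_subset[OF Ls _ WL] DC CL by blast
    have "p \<notin> \<pi>" using disjoint[OF \<rho> \<pi> False p(2)] .
    then have pDC: "p_part p D = p_part p C" using idx p(1) by blast
    \<comment> \<open>Compare the product formulas for \<open>DW\<close> and \<open>CW = L\<close>.\<close>
    have "D \<inter> W = C \<inter> W" using DC WC by blast
    then have pDW: "p_part p (D <#> W) = p_part p L"
      using p_part_set_mult[OF Cs Ws p(1)] p_part_set_mult[OF Ds Ws p(1)] pDC unfolding CWL by simp
    have "h \<in> D <#> W"
    proof (rule p_element_mem_of_p_part_eq[OF DWs Ls DWL p(1) pDW hL h(2)])
      have hc: "h \<in> carrier G" by (rule subgroup.mem_carrier[OF Hs h(1)])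
      have "h \<in> normalizer G L"
        using mem_normalizer_iff[OF subgroup.subset[OF Ls]] hc subgroup_conj_mem[OF Ls hL] by blast
      then have hW: "h \<otimes> w \<otimes> inv h \<in> W" if "w \<in> W" for w
        using nrmW mem_normalizer_iff[OF subgroup.subset[OF Ws]] that by blast
      have "h \<otimes> x \<otimes> inv h \<in> D <#> W" if x: "x \<in> D <#> W" for x
      proof -
        obtain d w where dw: "d \<in> D" "w \<in> W" "x = d \<otimes> w" using x unfolding set_mult_def by blast
        have "h \<otimes> x \<otimes> inv h = (h \<otimes> d \<otimes> inv h) \<otimes> (h \<otimes> w \<otimes> inv h)"
          unfolding dw(3) by (rule conj_mult[OF hc subgroup.mem_carrier[OF Ds dw(1)] subgroup.mem_carrier[OF Ws dw(2)]])
        then show ?thesis using set_multI[OF normal_conj_mem[OF D hc dw(1)] hW[OF dw(2)]] by simp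
      qed
      then show "h \<in> normalizer G (D <#> W)" using mem_normalizer_iff[OF subgroup.subset[OF DWs]] hc by blast
    qed
    then obtain d w where dw: "d \<in> D" "w \<in> W" "h = d \<otimes> w" unfolding set_mult_def by blast
    \<comment> \<open>In \<open>w = cx\<close> both \<open>w\<close> and \<open>x\<close> lie in \<open>W\<close>, so \<open>c \<in> W \<inter> C \<subseteq> D\<close> can be absorbed.\<close>
    obtain c x where cx: "c \<in> C" "x \<in> B \<inter> L" "w = c \<otimes> x" using LCX WL dw(2) by blast
    have m: "d \<in> carrier G" "c \<in> carrier G" "x \<in> carrier G"
      using subgroup.mem_carrier[OF Ds dw(1)] subgroup.mem_carrier[OF Cs cx(1)] subgroup.mem_carrier[OF Bs] cx(2) by auto
    have xW: "x \<in> W" using BLW cx(2) by blast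
    have "w \<otimes> inv x \<in> W" by (rule subgroup.m_closed[OF Ws dw(2) subgroup.m_inv_closed[OF Ws xW]])
    moreover have "w \<otimes> inv x = c" unfolding cx(3) using m by (simp add: m_assoc)
    ultimately have "c \<in> D" using WC cx(1) by blast
    then have "d \<otimes> c \<in> D" by (rule subgroup.m_closed[OF Ds dw(1)])
    moreover have "h = (d \<otimes> c) \<otimes> x" unfolding dw(3) cx(3) using m by (simp add: m_assoc)
    ultimately show ?thesis using set_multI[of "d \<otimes> c" D x B] cx(2) by simp
  qed
  then show "h \<in> radical_over_core \<rho> H" unfolding radical_over_core_def D_def by blast
qed

text \<open>Induction from larger to smaller permutable subgroups.  If all members of the family normalize
  \<open>H\<close>, then \<open>H\<close> is normal, since the family generates \<open>G\<close>, and equals its core.  Otherwise \<open>H\<close> and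
  a conjugate by an offending element \<open>b \<in> B\<close> generate a larger permutable subgroup inside \<open>HB\<close>.\<close>

lemma permutable_primary_elements_in_radicals:
  "permutable H \<Longrightarrow> primary_elements_in_radicals H"
proof (induction "card (carrier G) - card H" arbitrary: H rule: less_induct)
  case less
  note H = less.prems
  note Hs = permutable_imp_subgroup[OF H]
  show ?case
  proof (cases "\<exists>\<pi>\<in>\<sigma>. \<exists>B\<in>Q \<pi>. \<not> B \<subseteq> normalizer G H")
    case True
    then obtain \<pi> B b where B: "\<pi> \<in> \<sigma>" "B \<in> Q \<pi>" and b: "b \<in> B" "b \<notin> normalizer G H" by blast
    have bc: "b \<in> carrier G" by (rule subgroup.mem_carrier[OF family_subgroup[OF B] b(1)])
    define A where "A = generate G (H \<union> conj_set b H)"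
    have A: "permutable A" unfolding A_def by (rule permutable_generate[OF H permutable_conj_set[OF H bc]])
    note As = permutable_imp_subgroup[OF A]
    have HA: "H \<subseteq> A" "conj_set b H \<subseteq> A"
      unfolding A_def using generate.incl[of _ "H \<union> conj_set b H" G] by blast+
    note Ts = subgroup_permutable_product[OF H B]
    have bT: "b \<in> H <#> B" using permutable_subset_product(2)[OF H B] b(1) by blast
    have HT: "H \<subseteq> H <#> B" by (rule permutable_subset_product(1)[OF H B])
    have "conj_set b H \<subseteq> H <#> B"
    proof (rule image_subsetI)
      fix k assume "k \<in> H"
      then show "b \<otimes> k \<otimes> inv b \<in> H <#> B" by (rule subgroup_conj_mem[OF Ts bT subsetD[OF HT]])
    qed
    then have AT: "A \<subseteq> H <#> B" unfolding A_def using HT by (intro generate_subgroup_incl[OF _ Ts]) simp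
    have idx: "same_index_outside \<pi> H A" by (rule same_index_outside_of_product[OF H B As HA(1) AT])
    have "\<not> conj_set b H \<subseteq> H" using b(2) bc mem_normalizer_iff[OF subgroup.subset[OF Hs]] by blast
    then have "H \<noteq> A" using HA(2) by blast
    then have "card H < card A" using HA(1) psubset_card_mono[OF finite_subgroup[OF As]] by blast
    moreover have "card A \<le> card (carrier G)" by (rule card_mono[OF finite_carrier subgroup.subset[OF As]])
    ultimately have "primary_elements_in_radicals A" by (intro less.hyps[OF _ A]) simp
    then show ?thesis by (rule primary_elements_in_radicals_step[OF H A HA(1) idx B(1)])
  next
    case False
    have Ns: "subgroup (normalizer G H) G" by (rule subgroup_normalizer[OF subgroup.subset[OF Hs]])
    have "g \<in> normalizer G H" if g: "g \<in> carrier G" for g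
    proof -
      obtain \<pi> where \<pi>: "\<pi> \<in> \<sigma>" using cover[OF two_is_prime_nat] by blast
      obtain B where B: "B \<in> Q \<pi>" using family_nonempty[OF \<pi>] by blast
      obtain c r where cr: "c \<in> B" "r \<in> residual \<pi>" "g = c \<otimes> r" using family_residual_decompose[OF \<pi> B g] by blast
      have "residual \<pi> \<subseteq> normalizer G H" using False by (intro residual_subset[OF Ns]) blast
      then have rN: "r \<in> normalizer G H" using cr(2) by blast
      have cN: "c \<in> normalizer G H" using False \<pi> B cr(1) by blast
      show ?thesis unfolding cr(3) by (rule subgroup.m_closed[OF Ns cN rN])
    qed
    then have "H \<lhd> G" using mem_normalizer_iff[OF subgroup.subset[OF Hs]] by (intro normalI_conj[OF Hs]) blast
    then have "H \<subseteq> core H" by (rule normal_subset_core) simp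
    then show ?thesis
      using core_subset_radical[OF Hs] unfolding primary_elements_in_radicals_def by blast
  qed
qed

section \<open>The normalizer of a permutable subgroup\<close>

text \<open>An element normalizing every \<open>H \<inter> O\<^sub>\<pi>\<close> sends all elements of prime power order of \<open>H\<close> into \<open>H\<close>,
  and these generate \<open>H\<close>.\<close>

lemma normalizer_eq_Inter_normalizers:
  assumes H: "permutable H"
  shows "normalizer G H = (\<Inter>\<pi>\<in>\<sigma>. normalizer G (H \<inter> radical_over_core \<pi> H))"
proof
  note Hs = permutable_imp_subgroup[OF H]
  note memH = mem_normalizer_iff[OF subgroup.subset[OF Hs]]
  have sub: "H \<inter> radical_over_core \<pi> H \<subseteq> carrier G" for \<pi> using subgroup.subset[OF Hs] by blast
  note memK = mem_normalizer_iff[OF sub]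
  show "normalizer G H \<subseteq> (\<Inter>\<pi>\<in>\<sigma>. normalizer G (H \<inter> radical_over_core \<pi> H))"
  proof (intro subsetI INT_I)
    fix g \<pi> assume g: "g \<in> normalizer G H" and \<pi>: "\<pi> \<in> \<sigma>"
    then have gc: "g \<in> carrier G" using memH by blast
    show "g \<in> normalizer G (H \<inter> radical_over_core \<pi> H)"
      using g gc memH memK normal_conj_mem[OF radical_normal[OF Hs \<pi>] gc] by blast
  qed
  show "(\<Inter>\<pi>\<in>\<sigma>. normalizer G (H \<inter> radical_over_core \<pi> H)) \<subseteq> normalizer G H"
  proof
    fix g assume g: "g \<in> (\<Inter>\<pi>\<in>\<sigma>. normalizer G (H \<inter> radical_over_core \<pi> H))"
    obtain \<pi>0 where "\<pi>0 \<in> \<sigma>" using cover[OF two_is_prime_nat] by blast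
    then have gc: "g \<in> carrier G" using g memK by blast
    \<comment> \<open>\<open>K\<close> consists of the elements of \<open>H\<close> whose conjugates by \<open>g\<close> remain in \<open>H\<close>.\<close>
    define K where "K = H \<inter> conj_set (inv g) H"
    have Ks: "subgroup K G"
      unfolding K_def by (rule subgroups_Inter_pair[OF Hs subgroup_conj_set[OF Hs inv_closed[OF gc]]])
    have "K = H"
    proof (rule subgroup_eqI_p_elements[OF Ks Hs])
      show "K \<subseteq> H" unfolding K_def by blast
      fix p h assume p: "Factorial_Ring.prime p" and h: "h \<in> H" "p_element p h"
      obtain \<pi> where \<pi>: "\<pi> \<in> \<sigma>" "p \<in> \<pi>" using cover[OF p] by blast
      have "h \<in> radical_over_core \<pi> H"
        using permutable_primary_elements_in_radicals[OF H] \<pi> p h unfolding primary_elements_in_radicals_def by blast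
      then have "g \<otimes> h \<otimes> inv g \<in> H" using g \<pi>(1) memK h(1) by blast
      moreover have "h = inv g \<otimes> (g \<otimes> h \<otimes> inv g) \<otimes> inv (inv g)"
        using gc subgroup.mem_carrier[OF Hs h(1)] by (simp add: m_assoc)
      ultimately have "h \<in> conj_set (inv g) H" by (rule rev_image_eqI)
      then show "h \<in> K" unfolding K_def using h(1) by blast
    qed
    have "g \<otimes> h \<otimes> inv g \<in> H" if h: "h \<in> H" for h
    proof -
      have "h \<in> conj_set (inv g) H" using h \<open>K = H\<close> unfolding K_def by blast
      then obtain k where k: "h = inv g \<otimes> k \<otimes> inv (inv g)" "k \<in> H" by (rule imageE)
      have "g \<otimes> h \<otimes> inv g = k" unfolding k(1) using gc subgroup.mem_carrier[OF Hs k(2)] by (simp add: m_assoc)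
      then show ?thesis using k(2) by simp
    qed
    then show "g \<in> normalizer G H" using memH gc by blast
  qed
qed

text \<open>Rewrite \<open>ab\<close> as \<open>cr\<close> with \<open>c \<in> B\<close> and \<open>r\<close> in the \<open>\<pi>\<close>-residual.  Then \<open>r\<close> normalizes \<open>H \<inter> O\<^sub>\<pi>\<close> as an
  element of the residual, and \<open>H \<inter> O\<^sub>\<rho>\<close> for \<open>\<rho> \<noteq> \<pi>\<close> because \<open>a\<close>, \<open>b\<close> and \<open>c\<close> do.\<close>

lemma permutable_normalizer:
  assumes H: "permutable H"
  shows "permutable (normalizer G H)"
  unfolding permutable_def
proof (intro conjI ballI)
  note Hs = permutable_imp_subgroup[OF H]
  let ?N = "\<lambda>\<pi>. normalizer G (H \<inter> radical_over_core \<pi> H)"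
  show Ns: "subgroup (normalizer G H) G" by (rule subgroup_normalizer[OF subgroup.subset[OF Hs]])
  have Nps: "subgroup (?N \<pi>) G" for \<pi>
    using subgroup.subset[OF Hs] by (intro subgroup_normalizer) blast
  fix \<pi> B assume B: "\<pi> \<in> \<sigma>" "B \<in> Q \<pi>"
  note Bs = family_subgroup[OF B]
  have BN: "B \<subseteq> ?N \<rho>" if "\<rho> \<in> \<sigma>" "\<rho> \<noteq> \<pi>" for \<rho>
    using family_subset_normalizer_radical_Int[OF H that(1) B(1) _ B(2)] that(2) by blast
  show "normalizer G H <#> B = B <#> normalizer G H"
  proof (rule set_mult_commuteI[OF Ns Bs])
    fix a b assume a: "a \<in> normalizer G H" and b: "b \<in> B"
    have ac: "a \<in> carrier G" "b \<in> carrier G"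
      using subgroup.mem_carrier[OF Ns a] subgroup.mem_carrier[OF Bs b] by auto
    obtain c r where cr: "c \<in> B" "r \<in> residual \<pi>" "a \<otimes> b = c \<otimes> r"
      using family_residual_decompose[OF B m_closed[OF ac]] by blast
    have "r \<in> ?N \<rho>" if \<rho>: "\<rho> \<in> \<sigma>" for \<rho>
    proof (cases "\<rho> = \<pi>")
      case True
      then show ?thesis using residual_subset_normalizer_radical_Int[OF H B(1)] cr(2) by blast
    next
      case False
      have "a \<in> ?N \<rho>" using a \<rho> normalizer_eq_Inter_normalizers[OF H] by blast
      moreover have "b \<in> ?N \<rho>" using BN[OF \<rho> False] b by blast
      moreover have "c \<in> ?N \<rho>" using BN[OF \<rho> False] cr(1) by blast
      ultimately have "inv c \<otimes> (a \<otimes> b) \<in> ?N \<rho>"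
        by (intro subgroup.m_closed[OF Nps] subgroup.m_inv_closed[OF Nps])
      moreover have "inv c \<otimes> (a \<otimes> b) = r"
        unfolding cr(3) using subgroup.mem_carrier[OF Bs cr(1)] subgroup.mem_carrier[OF subgroup_residual cr(2)] by simp
      ultimately show ?thesis by simp
    qed
    then have "r \<in> normalizer G H" using normalizer_eq_Inter_normalizers[OF H] by blast
    then show "a \<otimes> b \<in> B <#> normalizer G H" unfolding cr(3) by (rule set_multI[OF cr(1)])
  qed
qed

end

section \<open>The conjugates of projectors form a projector family\<close>

context finite_group
begin

lemma card_conj_set:
  assumes "K \<subseteq> carrier G" "g \<in> carrier G"
  shows "card (conj_set g K) = card K"
proof (rule card_image)
  show "inj_on (\<lambda>k. g \<otimes> k \<otimes> inv g) K"
    using assms by (auto simp: inj_on_def subset_iff)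
qed

lemma conjugate_by_eq: "x \<in> carrier G \<Longrightarrow> conjugate_by G P x = conj_set (inv x) P"
  by (auto simp: conjugate_by_def l_coset_def r_coset_def)

lemma carrier_subgroup_Mod:
  "carrier (G\<lparr>carrier := L\<rparr> Mod N) = (\<lambda>a. N #> a) ` L"
  by (auto simp: FactGroup_def RCOSETS_def r_coset_def)

lemma card_subgroup_Mod:
  assumes "subgroup N G" "subgroup L G" "N \<subseteq> L"
  shows "card ((\<lambda>a. N #> a) ` L) * card N = card L"
proof -
  interpret L: group "G\<lparr>carrier := L\<rparr>" using assms(2) subgroup_imp_group by blast
  have "card (rcosets\<^bsub>G\<lparr>carrier := L\<rparr>\<^esub> N) * card N = order (G\<lparr>carrier := L\<rparr>)"
    by (rule L.lagrange[OF subgroup_incl[OF assms]])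
  moreover have "rcosets\<^bsub>G\<lparr>carrier := L\<rparr>\<^esub> N = (\<lambda>a. N #> a) ` L"
    by (auto simp: RCOSETS_def r_coset_def)
  ultimately show ?thesis by (simp add: order_def)
qed

text \<open>The case \<open>N = 1\<close> of the projector property.\<close>

lemma pi_projector_p_part:
  assumes P: "pi_projector \<pi> G P" and p: "Factorial_Ring.prime p" "p \<notin> \<pi>"
  shows "p_part p P = 0"
proof -
  have Ps: "subgroup P G" using P by (simp add: pi_projector_def)
  have one: "{\<one>} \<lhd> G" by (simp add: normal_inv_iff triv_subgroup)
  have eq: "P <#> {\<one>} = P" using subgroup.mem_carrier[OF Ps] by (auto simp: set_mult_def)
  have "maximal_pi_subgroup \<pi> (G Mod {\<one>}) (carrier (G\<lparr>carrier := P <#> {\<one>}\<rparr> Mod {\<one>}))"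
    using P one unfolding pi_projector_def by blast
  then have "\<not> p dvd card ((\<lambda>a. {\<one>} #> a) ` P)"
    using p unfolding maximal_pi_subgroup_def pi_subgroup_def pi_group_def carrier_subgroup_Mod eq
    by (auto simp: order_def)
  then have "\<not> p dvd card P"
    using card_subgroup_Mod[OF normal_imp_subgroup[OF one] Ps] subgroup.one_closed[OF Ps] by simp
  then show ?thesis by (rule not_dvd_imp_multiplicity_0)
qed

text \<open>The image of \<open>L\<close> in \<open>G/N\<close> is a \<open>\<pi>\<close>-group containing the maximal \<open>\<pi>\<close>-subgroup \<open>PN/N\<close>.\<close>

lemma pi_projector_maximal:
  assumes P: "pi_projector \<pi> G P" and N: "N \<lhd> G" and L: "subgroup L G" "P <#> N \<subseteq> L"
    and idx: "same_index_outside \<pi> N L"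
  shows "L \<subseteq> P <#> N"
proof
  note Ns = normal_imp_subgroup[OF N]
  have Ps: "subgroup P G" using P by (simp add: pi_projector_def)
  have PNs: "subgroup (P <#> N) G" by (rule subgroup_set_mult[OF Ps Ns set_mult_commute_normal[OF N Ps]])
  have NPN: "N \<subseteq> P <#> N" by (rule subset_set_mult_right[OF Ps subgroup.subset[OF Ns]])
  have NL: "N \<subseteq> L" using NPN L(2) by (rule subset_trans)
  let ?q = "\<lambda>a. N #> a"
  have max: "maximal_pi_subgroup \<pi> (G Mod N) (?q ` (P <#> N))"
    using P N unfolding pi_projector_def carrier_subgroup_Mod by blast
  interpret q: group_hom G "G Mod N" ?q
    using normal.factorgroup_is_group[OF N] normal.r_coset_hom_Mod[OF N]
    by (simp add: group_hom_def group_hom_axioms_def)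
  have sub: "subgroup (?q ` L) (G Mod N)" by (rule q.subgroup_img_is_subgroup[OF L(1)])
  have "p \<in> \<pi>" if p: "Factorial_Ring.prime p" "p dvd card (?q ` L)" for p
  proof (rule ccontr)
    assume "p \<notin> \<pi>"
    then have eq: "p_part p N = p_part p L" using idx p(1) by blast
    have c: "card (?q ` L) * card N = card L" by (rule card_subgroup_Mod[OF Ns L(1) NL])
    have pos: "card (?q ` L) \<noteq> 0" "card N \<noteq> 0" using c card_subgroup_pos[OF L(1)] by (metis mult_0 mult_0_right less_irrefl)+
    have "p_part p L = p_part p (?q ` L) + p_part p N"
      unfolding c[symmetric] by (rule prime_elem_multiplicity_mult_distrib[OF prime_imp_prime_elem[OF p(1)] pos])
    then have "p_part p (?q ` L) = 0" using eq by simp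
    then show False using p(2) prime_elem_multiplicity_eq_zero_iff[OF prime_imp_prime_elem[OF p(1)] pos(1)] by blast
  qed
  then have "pi_subgroup \<pi> (G Mod N) (?q ` L)"
    using sub group.subgroup_imp_group[OF normal.factorgroup_is_group[OF N] sub] finite_subgroup[OF L(1)]
    by (simp add: pi_subgroup_def pi_group_def order_def)
  moreover have "?q ` (P <#> N) \<subseteq> ?q ` L" using L(2) by (rule image_mono)
  ultimately have eq: "?q ` (P <#> N) = ?q ` L" using max unfolding maximal_pi_subgroup_def by blast
  fix l assume l: "l \<in> L"
  then have "?q l \<in> ?q ` (P <#> N)" using eq by blast
  then obtain x where x: "?q l = ?q x" "x \<in> P <#> N" by (rule imageE)
  have "l \<in> ?q x" using rcos_self[OF subgroup.mem_carrier[OF L(1) l] Ns] unfolding x(1) .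
  then obtain n where n: "n \<in> N" "l = n \<otimes> x" unfolding r_coset_def by blast
  show "l \<in> P <#> N" unfolding n(2) by (rule subgroup.m_closed[OF PNs subsetD[OF NPN n(1)] x(2)])
qed

lemma pi_projector_conj_maximal:
  assumes P: "pi_projector \<pi> G P" and g: "g \<in> carrier G" and N: "N \<lhd> G"
    and L: "subgroup L G" "conj_set g P <#> N \<subseteq> L" and idx: "same_index_outside \<pi> N L"
  shows "L \<subseteq> conj_set g P <#> N"
proof
  note Ns = normal_imp_subgroup[OF N]
  have Ps: "subgroup P G" using P by (simp add: pi_projector_def)
  let ?L = "conj_set (inv g) L"
  have unconj: "inv g \<otimes> (g \<otimes> x \<otimes> inv g) \<otimes> inv (inv g) = x" if "x \<in> carrier G" for x
    using that g by (simp add: m_assoc)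
  have reconj: "g \<otimes> (inv g \<otimes> x \<otimes> inv (inv g)) \<otimes> inv g = x" if "x \<in> carrier G" for x
    using that g by (simp add: m_assoc)
  have conj_PN: "g \<otimes> x \<otimes> inv g \<in> conj_set g P <#> N" if x: "x \<in> P <#> N" for x
  proof -
    obtain a n where an: "a \<in> P" "n \<in> N" "x = a \<otimes> n" using x unfolding set_mult_def by blast
    have "g \<otimes> x \<otimes> inv g = (g \<otimes> a \<otimes> inv g) \<otimes> (g \<otimes> n \<otimes> inv g)"
      unfolding an(3) by (rule conj_mult[OF g subgroup.mem_carrier[OF Ps an(1)] subgroup.mem_carrier[OF Ns an(2)]])
    then show ?thesis using set_multI[OF imageI[OF an(1)] normal_conj_mem[OF N g an(2)]] by simp
  qed
  have PN: "P <#> N \<subseteq> carrier G" by (rule set_mult_closed[OF subgroup.subset[OF Ps] subgroup.subset[OF Ns]])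
  have "?L \<subseteq> P <#> N"
  proof (rule pi_projector_maximal[OF P N subgroup_conj_set[OF L(1) inv_closed[OF g]]])
    show "P <#> N \<subseteq> ?L"
    proof
      fix x assume x: "x \<in> P <#> N"
      have "g \<otimes> x \<otimes> inv g \<in> L" by (rule subsetD[OF L(2) conj_PN[OF x]])
      then show "x \<in> ?L" using unconj[OF subsetD[OF PN x], symmetric] by (rule rev_image_eqI)
    qed
    show "same_index_outside \<pi> N ?L"
      using idx card_conj_set[OF subgroup.subset[OF L(1)] inv_closed[OF g]] by simp
  qed
  fix l assume l: "l \<in> L"
  have "inv g \<otimes> l \<otimes> inv (inv g) \<in> P <#> N" by (rule subsetD[OF \<open>?L \<subseteq> P <#> N\<close> imageI[OF l]])
  from conj_PN[OF this] show "l \<in> conj_set g P <#> N" unfolding reconj[OF subgroup.mem_carrier[OF L(1) l]] .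
qed

lemma projector_family_conjugates:
  assumes disj: "\<And>\<pi> \<rho> p. \<pi> \<in> \<sigma> \<Longrightarrow> \<rho> \<in> \<sigma> \<Longrightarrow> \<pi> \<noteq> \<rho> \<Longrightarrow> p \<in> \<pi> \<Longrightarrow> p \<notin> \<rho>"
    and cover: "\<And>p. Factorial_Ring.prime p \<Longrightarrow> \<exists>\<pi>\<in>\<sigma>. p \<in> \<pi>"
    and P: "\<And>\<pi>. \<pi> \<in> \<sigma> \<Longrightarrow> pi_projector \<pi> G (P \<pi>)"
  shows "projector_family G \<sigma> (\<lambda>\<pi>. (\<lambda>g. conj_set g (P \<pi>)) ` carrier G)"
proof (rule projector_family.intro[OF finite_group_axioms], rule projector_family_axioms.intro, goal_cases)
  case (1 \<pi> \<rho> p)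
  then show ?case using disj by blast
next
  case (2 p)
  then show ?case by (rule cover)
next
  case (3 \<pi>)
  show ?case using one_closed by blast
next
  case (4 \<pi> B)
  have "subgroup (P \<pi>) G" using P[OF 4(1)] unfolding pi_projector_def by blast
  moreover obtain g where "B = conj_set g (P \<pi>)" "g \<in> carrier G" using 4(2) by (rule imageE)
  ultimately show ?case by (simp only: subgroup_conj_set)
next
  case (5 \<pi> B p)
  obtain g where g: "B = conj_set g (P \<pi>)" "g \<in> carrier G" using 5(2) by (rule imageE)
  have "subgroup (P \<pi>) G" using P[OF 5(1)] unfolding pi_projector_def by blast
  then have "card B = card (P \<pi>)" unfolding g(1) using g(2) by (intro card_conj_set subgroup.subset)
  then show ?case using pi_projector_p_part[OF P[OF 5(1)] 5(3,4)] by simp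
next
  case (6 \<pi> B g)
  obtain x where x: "B = conj_set x (P \<pi>)" "x \<in> carrier G" using 6(2) by (rule imageE)
  have Ps: "subgroup (P \<pi>) G" using P[OF 6(1)] unfolding pi_projector_def by blast
  have "conj_set g B = conj_set (g \<otimes> x) (P \<pi>)"
    unfolding x(1) image_image
    by (rule image_cong[OF refl conj_conj[OF 6(3) x(2) subgroup.mem_carrier[OF Ps]]])
  then show ?case using m_closed[OF 6(3) x(2)] by (rule image_eqI)
next
  case (7 \<pi> B N L)
  obtain g where g: "B = conj_set g (P \<pi>)" "g \<in> carrier G" using 7(2) by (rule imageE)
  show ?case
    using 7(5) unfolding g(1) by (rule pi_projector_conj_maximal[OF P[OF 7(1)] g(2) 7(3,4) _ 7(6)])
qed

end

theorem theorem5: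
  fixes G :: "('a, 'b) monoid_scheme"
    and \<pi> :: "'i \<Rightarrow> nat set" and I :: "'i set" and \<sigma> :: "nat set set"
    and H :: "'a set"
  assumes "disjoint_family_on \<pi> I"
    and "(\<Union>i\<in>I. \<pi> i) = {p. Factorial_Ring.prime p}"
    and "\<sigma> = {\<pi> i | i. i \<in> I}"
    and "group G" and "finite (carrier G)"
    and "sigma3_permutable \<sigma> G H"
  shows "sigma3_permutable \<sigma> G (normalizer G H)"
proof -
  interpret finite_group G
    using assms(4,5) by (simp add: finite_group_def finite_group_axioms_def)
  obtain P where P: "\<And>\<tau>. \<tau> \<in> \<sigma> \<Longrightarrow> pi_projector \<tau> G (P \<tau>)"
    and comm: "\<And>\<tau> x. \<tau> \<in> \<sigma> \<Longrightarrow> x \<in> carrier G \<Longrightarrow>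
      H <#>\<^bsub>G\<^esub> conjugate_by G (P \<tau>) x = conjugate_by G (P \<tau>) x <#>\<^bsub>G\<^esub> H"
    using assms(6) unfolding sigma3_permutable_def by metis
  let ?Q = "\<lambda>\<tau>. (\<lambda>g. conj_set g (P \<tau>)) ` carrier G"
  interpret projector_family G \<sigma> ?Q
  proof (rule projector_family_conjugates[OF _ _ P])
    fix \<tau> \<rho> p assume "\<tau> \<in> \<sigma>" "\<rho> \<in> \<sigma>" "\<tau> \<noteq> \<rho>" "p \<in> \<tau>"
    then obtain i j where "i \<in> I" "j \<in> I" "\<tau> = \<pi> i" "\<rho> = \<pi> j" "i \<noteq> j" using assms(3) by auto
    then have "\<tau> \<inter> \<rho> = {}" using assms(1) by (simp add: disjoint_family_on_def)
    then show "p \<notin> \<rho>" using \<open>p \<in> \<tau>\<close> by blast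
  next
    fix p :: nat assume "Factorial_Ring.prime p"
    then obtain i where "i \<in> I" "p \<in> \<pi> i" using assms(2) by blast
    then show "\<exists>\<tau>\<in>\<sigma>. p \<in> \<tau>" using assms(3) by blast
  qed
  have Q: "?Q \<tau> = conjugate_by G (P \<tau>) ` carrier G" for \<tau>
  proof (intro equalityI image_subsetI)
    fix x assume x: "x \<in> carrier G"
    have "conjugate_by G (P \<tau>) (inv\<^bsub>G\<^esub> x) = conj_set x (P \<tau>)"
      using conjugate_by_eq[OF inv_closed[OF x]] inv_inv[OF x] by simp
    then show "conj_set x (P \<tau>) \<in> conjugate_by G (P \<tau>) ` carrier G"
      by (metis image_eqI inv_closed[OF x])
    show "conjugate_by G (P \<tau>) x \<in> ?Q \<tau>"
      unfolding conjugate_by_eq[OF x] by (rule imageI[OF inv_closed[OF x]])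
  qed
  have iff: "permutable K \<longleftrightarrow> subgroup K G \<and> (\<forall>\<tau>\<in>\<sigma>. \<forall>x\<in>carrier G.
      K <#>\<^bsub>G\<^esub> conjugate_by G (P \<tau>) x = conjugate_by G (P \<tau>) x <#>\<^bsub>G\<^esub> K)" for K
    unfolding permutable_def unfolding Q by simp
  have "permutable H"
    using assms(6) comm unfolding iff sigma3_permutable_def by simp
  then have "permutable (normalizer G H)" by (rule permutable_normalizer)
  then show ?thesis using P unfolding iff sigma3_permutable_def by blast
qed

end
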